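(* Let $t_0\in\mathbb{R}$, $T\in(\mathbb{R}\setminus\{t_0\})\cup\{\pm\infty\}$, let $\mathcal{P}$ be the open segment of the real axis between $t_0$ and $T$, and let $\phi:\mathcal{P}\to(0,\infty)$ and $a:\mathcal{P}\to\mathbb{C}$ be continuous. Suppose that $\phi(t)>\phi(t_0)\ge0$ for every $t\in\mathcal{P}\cup\{T\}$, and that there is $\lambda_0\ge0$ with $\int_{\mathcal{P}}e^{-\lambda_0\phi(t)}|a(t)|\,dt<\infty$. Define $$\varphi(t):=\exp\bigl\{1-(1-e^{-\phi(t)})^{-1}\bigr\}\qquad(t\in\mathcal{P}).$$ If the pair $(a,\varphi)$ satisfies the factorization condition (F) of the context, then, with $\chi_n$, $\operatorname{c}_{\mathcal{P}}(n)$, $\omega_{\mathcal{P}}$ and Tricomi's function $U$ as in the context, $$\int_{\mathcal{P}}e^{-\lambda\phi(t)}a(t)\,dt\;\sim\;e^{i\omega_{\mathcal{P}}}\,\Gamma(\lambda+1)\sum_{n=0}^\infty U(\lambda+1,2,\chi_n)\,\operatorname{c}_{\mathcal{P}}(n)\qquad(\lambda\to\infty).$$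
   Context: Conventions. Integrals over $\mathcal{P}$ are with respect to Lebesgue measure $dt$. For a function $f$ on $\mathcal{P}$ and $\tau\in\{t_0,T\}$, $f(\tau):=\lim_{t\to\tau,\,t\in\mathcal{P}}f(t)$ ($\phi(T)$ may be $+\infty$). $\omega_{\mathcal{P}}:=0$ if $T>t_0$, $\omega_{\mathcal{P}}:=\pi$ if $T<t_0$. $D_R(t_0)=\{t\in\mathbb{C}:|t-t_0|<R\}$, $\mathcal{P}_R:=\mathcal{P}\cap D_R(t_0)$. Condition (F). There exist $R>0$, $\alpha_0\in\mathbb{C}$ with $\Re\alpha_0>-1$, $\beta_0>0$, and analytic functions $q,p:D_R(t_0)\to\mathbb{C}$ with $p(t_0)\ne0$, such that $\varphi(t)>0$ and $$a(t)=(t-t_0)^{\alpha_0}q(t),\qquad\varphi(t)=(t-t_0)^{\beta_0}p(t)\qquad(t\in\mathcal{P}_R),$$ where $(t-t_0)^\gamma=|t-t_0|^\gamma e^{i\gamma\omega_{\mathcal{P}}}$ for $t\in\mathcal{P}_R$. Powers of $p$ use the branch with $\{p(t)\}^\kappa=|p(t)|^\kappa e^{-i\kappa\beta_0\omega_{\mathcal{P}}}$ for $t\in\mathcal{P}_R\cup\{t_0\}$, continued analytically to a neighbourhood of $t_0$. For $n\in\mathbb{N}_0$, $$\chi_n:=\frac{\alpha_0+1+n}{\beta_0},\qquad\operatorname{c}_{\mathcal{P}}(n):=\frac1{\beta_0}\frac1{n!}\frac{d^n}{dw^n}\frac{q(w)}{\{p(w)\}^{\chi_n}}\Big|_{w=t_0}.$$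 Tricomi's confluent hypergeometric function: for $\Re z,\Re b>0$ and $c\in\mathbb{C}$, $$U(b,c,z):=\frac1{\Gamma(b)}\int_0^\infty e^{-zt}t^{b-1}(1+t)^{c-b-1}\,dt.$$ Meaning of $\sim$: $L(\lambda)\sim\sum_{n\ge0}\Phi_n(\lambda)d_n$ means that for every $N\in\mathbb{N}$, $L(\lambda)-\sum_{n=0}^{N-1}\Phi_n(\lambda)d_n=o(\Phi_{N-1}(\lambda))$ as $\lambda\to\infty$; here $\Phi_n(\lambda)=\Gamma(\lambda+1)U(\lambda+1,2,\chi_n)$. *)

theory Defs
  imports "HOL-Complex_Analysis.Complex_Analysis" "HOL-Library.Landau_Symbols"
begin

definition segment_from :: "real \<Rightarrow> ereal \<Rightarrow> real set" where
  "segment_from t0 T = einterval (min (ereal t0) T) (max (ereal t0) T)"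

definition segment_arg :: "real \<Rightarrow> ereal \<Rightarrow> real" where
  "segment_arg t0 T = (if ereal t0 < T then 0 else pi)"

text \<open>The power \<open>(t - t0)\<^sup>\<gamma>\<close> on the segment, with \<open>arg (t - t0)\<close> equal to
  \<open>segment_arg t0 T\<close>.\<close>

definition segment_powr :: "real \<Rightarrow> ereal \<Rightarrow> complex \<Rightarrow> real \<Rightarrow> complex" where
  "segment_powr t0 T \<gamma> t =
     of_real \<bar>t - t0\<bar> powr \<gamma> * exp (\<i> * \<gamma> * of_real (segment_arg t0 T))"

definition factorization_condition ::
  "real \<Rightarrow> ereal \<Rightarrow> (real \<Rightarrow> complex) \<Rightarrow> (real \<Rightarrow> real) \<Rightarrow>
   real \<Rightarrow> complex \<Rightarrow> real \<Rightarrow> (complex \<Rightarrow> complex) \<Rightarrow> (complex \<Rightarrow> complex) \<Rightarrow> bool" where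
  "factorization_condition t0 T a \<psi> R \<alpha>0 \<beta>0 q p \<longleftrightarrow>
     R > 0 \<and> Re \<alpha>0 > -1 \<and> \<beta>0 > 0 \<and>
     q analytic_on ball (of_real t0) R \<and> p analytic_on ball (of_real t0) R \<and>
     p (of_real t0) \<noteq> 0 \<and>
     (\<forall>t \<in> segment_from t0 T. \<bar>t - t0\<bar> < R \<longrightarrow>
        \<psi> t > 0 \<and>
        a t = segment_powr t0 T \<alpha>0 t * q (of_real t) \<and>
        of_real (\<psi> t) = segment_powr t0 T (of_real \<beta>0) t * p (of_real t))"

text \<open>Powers of \<open>p\<close>.  With \<open>\<omega> = segment_arg t0 T\<close>, the factor \<open>exp (\<i> \<beta>0 \<omega>)\<close> rotates the
  values of \<open>p\<close> on the segment onto the positive half-axis, where the principal power is used.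
  The lemmas \<open>branch_powr_segment\<close>, \<open>branch_powr_analytic\<close> and \<open>branch_powr_unique\<close> below show
  that, under the factorization condition, this is the only function analytic at \<open>t0\<close> (up to
  equality near \<open>t0\<close>) that takes the values \<open>\<bar>p(t)\<bar>\<^sup>\<kappa> exp (-\<i> \<kappa> \<beta>0 \<omega>)\<close> on the segment
  near \<open>t0\<close>.\<close>

definition branch_powr ::
  "real \<Rightarrow> ereal \<Rightarrow> real \<Rightarrow> (complex \<Rightarrow> complex) \<Rightarrow> complex \<Rightarrow> complex \<Rightarrow> complex" where
  "branch_powr t0 T \<beta>0 p \<kappa> w =
     (p w * exp (\<i> * of_real (\<beta>0 * segment_arg t0 T))) powr \<kappa> *
     exp (- (\<i> * \<kappa> * of_real (\<beta>0 * segment_arg t0 T)))"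

definition chi :: "complex \<Rightarrow> real \<Rightarrow> nat \<Rightarrow> complex" where
  "chi \<alpha>0 \<beta>0 n = (\<alpha>0 + 1 + of_nat n) / of_real \<beta>0"

definition coeff_c ::
  "real \<Rightarrow> ereal \<Rightarrow> complex \<Rightarrow> real \<Rightarrow> (complex \<Rightarrow> complex) \<Rightarrow> (complex \<Rightarrow> complex) \<Rightarrow>
   nat \<Rightarrow> complex" where
  "coeff_c t0 T \<alpha>0 \<beta>0 q p n =
     1 / of_real \<beta>0 * (1 / fact n) *
     (deriv ^^ n) (\<lambda>w. q w / branch_powr t0 T \<beta>0 p (chi \<alpha>0 \<beta>0 n) w) (of_real t0)"

text \<open>Only meaningful for \<open>Re b > 0\<close> and \<open>Re z > 0\<close>, where the integral converges absolutely.\<close>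

definition tricomi_U :: "complex \<Rightarrow> complex \<Rightarrow> complex \<Rightarrow> complex" where
  "tricomi_U b c z =
     1 / Gamma b *
     (LBINT t:{0<..}. exp (- (z * of_real t)) * of_real t powr (b - 1) *
                      of_real (1 + t) powr (c - b - 1))"

text \<open>The expansion \<open>L \<sim> \<Sum>n. \<Phi> n * d n\<close> at infinity.  For \<open>N = 0\<close> there is no condition
  (\<open>\<Phi> (N - 1)\<close> would not make sense).\<close>

definition asymp_expansion ::
  "(real \<Rightarrow> complex) \<Rightarrow> (nat \<Rightarrow> real \<Rightarrow> complex) \<Rightarrow> (nat \<Rightarrow> complex) \<Rightarrow> bool" where
  "asymp_expansion L \<Phi> d \<longleftrightarrow>
     (\<forall>N\<ge>1. (\<lambda>x. L x - (\<Sum>n<N. \<Phi> n x * d n)) \<in> o[at_top](\<Phi> (N - 1)))"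

lemma segment_factor_pos:
  assumes F: "factorization_condition t0 T a \<psi> R \<alpha>0 \<beta>0 q p"
    and t: "t \<in> segment_from t0 T" "\<bar>t - t0\<bar> < R"
  shows "norm (p (of_real t)) > 0"
    and "p (of_real t) * exp (\<i> * of_real (\<beta>0 * segment_arg t0 T)) = of_real (norm (p (of_real t)))"
proof -
  define E where "E = exp (\<i> * of_real (\<beta>0 * segment_arg t0 T))"
  have nE: "norm E = 1" by (simp add: E_def)
  have nz: "\<bar>t - t0\<bar> > 0"
    using t by (auto simp: segment_from_def einterval_def min_def max_def split: if_splits)
  define r where "r = \<psi> t / \<bar>t - t0\<bar> powr \<beta>0"
  have eq: "of_real (\<psi> t) = segment_powr t0 T (of_real \<beta>0) t * p (of_real t)" and pos: "\<psi> t > 0"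
    using F t by (auto simp: factorization_condition_def)
  have "of_real (\<psi> t) = of_real (\<bar>t - t0\<bar> powr \<beta>0) * (p (of_real t) * E)"
    using eq by (simp add: segment_powr_def E_def powr_of_real[symmetric] mult_ac)
  then have pE: "p (of_real t) * E = of_real r"
    using nz by (simp add: r_def field_simps)
  have r: "r > 0" using nz pos by (simp add: r_def)
  have "norm (p (of_real t)) = r"
    using arg_cong[OF pE, of norm] nE r by (simp add: norm_mult)
  then show "norm (p (of_real t)) > 0"
    and "p (of_real t) * exp (\<i> * of_real (\<beta>0 * segment_arg t0 T)) = of_real (norm (p (of_real t)))"
    using r pE by (auto simp: E_def)
qed

lemma segment_near_start:
  assumes "T \<noteq> ereal t0" "e > 0"
  obtains t where "t \<in> segment_from t0 T" "\<bar>t - t0\<bar> < e"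
proof (cases "ereal t0 < T")
  case True
  then obtain s where s: "ereal t0 < ereal s" "ereal s < T"
    using ereal_dense2 by blast
  define t where "t = min s (t0 + e / 2)"
  have "t \<le> s" by (simp add: t_def)
  then have "ereal t < T" using s(2) by (meson ereal_less_eq(3) le_less_trans)
  then show ?thesis
    using that[of t] True s(1) assms(2)
    by (auto simp: t_def segment_from_def einterval_def min_def max_def split: if_splits)
next
  case False
  then have "T < ereal t0" using assms(1) by auto
  then obtain s where s: "T < ereal s" "ereal s < ereal t0"
    using ereal_dense2 by blast
  define t where "t = max s (t0 - e / 2)"
  have "s \<le> t" by (simp add: t_def)
  then have "T < ereal t" using s(1) by (meson ereal_less_eq(3) less_le_trans)
  then show ?thesis
    using that[of t] \<open>T < ereal t0\<close> s(2) assms(2)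
    by (auto simp: t_def segment_from_def einterval_def min_def max_def split: if_splits)
qed

lemma start_islimpt:
  assumes "T \<noteq> ereal t0" "e > 0"
  shows "complex_of_real t0 islimpt (of_real ` {t \<in> segment_from t0 T. \<bar>t - t0\<bar> < e})"
  unfolding islimpt_approachable
proof (intro allI impI)
  fix d :: real assume "d > 0"
  then obtain t where t: "t \<in> segment_from t0 T" "\<bar>t - t0\<bar> < min d e"
    using segment_near_start[OF assms(1), of "min d e"] assms(2) by auto
  have "t \<noteq> t0"
    using t by (auto simp: segment_from_def einterval_def min_def max_def split: if_splits)
  then show "\<exists>x'\<in>of_real ` {t \<in> segment_from t0 T. \<bar>t - t0\<bar> < e}.
      x' \<noteq> complex_of_real t0 \<and> dist x' (of_real t0) < d"
    using t by (intro bexI[of _ "of_real t"]) (auto simp: dist_of_real dist_real_def)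
qed

lemma start_factor_pos:
  assumes T: "T \<noteq> ereal t0"
    and F: "factorization_condition t0 T a \<psi> R \<alpha>0 \<beta>0 q p"
  shows "p (of_real t0) * exp (\<i> * of_real (\<beta>0 * segment_arg t0 T)) = of_real (norm (p (of_real t0)))"
proof -
  define E where "E = exp (\<i> * of_real (\<beta>0 * segment_arg t0 T))"
  define A where "A = complex_of_real ` {t \<in> segment_from t0 T. \<bar>t - t0\<bar> < R}"
  have R: "R > 0" and pa: "p analytic_on ball (of_real t0) R"
    using F by (auto simp: factorization_condition_def)
  have cont: "isCont p (of_real t0)"
    using pa R by (meson analytic_at_imp_isCont analytic_on_subset centre_in_ball
        empty_subsetI insert_subset)
  have lim: "((\<lambda>w. p w * E - of_real (norm (p w))) \<longlongrightarrow>
      p (of_real t0) * E - of_real (norm (p (of_real t0)))) (at (of_real t0) within A)"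
    using cont
    by (intro tendsto_intros tendsto_norm) (auto simp: isCont_def intro: tendsto_within_subset)
  have "eventually (\<lambda>w. p w * E - of_real (norm (p w)) = 0) (at (of_real t0) within A)"
    unfolding eventually_at_filter
    by (rule always_eventually) (use segment_factor_pos(2)[OF F] in \<open>auto simp: A_def E_def\<close>)
  then have "((\<lambda>w. p w * E - of_real (norm (p w))) \<longlongrightarrow> 0) (at (of_real t0) within A)"
    by (rule tendsto_eventually)
  moreover have "at (of_real t0) within A \<noteq> bot"
    using start_islimpt[OF T R] by (simp add: A_def trivial_limit_within)
  ultimately have "p (of_real t0) * E - of_real (norm (p (of_real t0))) = 0"
    using lim tendsto_unique by blast
  then show ?thesis by (simp add: E_def)
qed

lemma branch_powr_segment:
  assumes T: "T \<noteq> ereal t0"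
    and F: "factorization_condition t0 T a \<psi> R \<alpha>0 \<beta>0 q p"
    and t: "t = t0 \<or> t \<in> segment_from t0 T \<and> \<bar>t - t0\<bar> < R"
  shows "branch_powr t0 T \<beta>0 p \<kappa> (of_real t) =
    of_real (norm (p (of_real t))) powr \<kappa> * exp (- (\<i> * \<kappa> * of_real (\<beta>0 * segment_arg t0 T)))"
  using t start_factor_pos[OF T F] segment_factor_pos(2)[OF F, of t]
  unfolding branch_powr_def by metis

lemma branch_powr_analytic:
  assumes T: "T \<noteq> ereal t0"
    and F: "factorization_condition t0 T a \<psi> R \<alpha>0 \<beta>0 q p"
  shows "branch_powr t0 T \<beta>0 p \<kappa> analytic_on {of_real t0}"
proof -
  have R: "R > 0" "p analytic_on ball (of_real t0) R" and nz: "p (of_real t0) \<noteq> 0"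
    using F by (auto simp: factorization_condition_def)
  have pa: "p analytic_on {of_real t0}"
    using R by (auto intro: analytic_on_subset)
  have "p (of_real t0) * exp (\<i> * of_real (\<beta>0 * segment_arg t0 T)) \<notin> \<real>\<^sub>\<le>\<^sub>0"
    unfolding start_factor_pos[OF T F] using nz by simp
  then show ?thesis
    unfolding branch_powr_def [abs_def] using pa
    by (intro analytic_intros) auto
qed

lemma branch_powr_unique:
  assumes T: "T \<noteq> ereal t0"
    and F: "factorization_condition t0 T a \<psi> R \<alpha>0 \<beta>0 q p"
    and g: "g analytic_on {of_real t0}" and e: "e > 0"
    and gval: "\<And>t. t \<in> segment_from t0 T \<Longrightarrow> \<bar>t - t0\<bar> < e \<Longrightarrow> g (of_real t) =
      of_real (norm (p (of_real t))) powr \<kappa> * exp (- (\<i> * \<kappa> * of_real (\<beta>0 * segment_arg t0 T)))"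
  shows "eventually (\<lambda>w. g w = branch_powr t0 T \<beta>0 p \<kappa> w) (nhds (of_real t0))"
proof -
  have R: "R > 0" using F by (auto simp: factorization_condition_def)
  define h where "h = (\<lambda>w. g w - branch_powr t0 T \<beta>0 p \<kappa> w)"
  have "h analytic_on {of_real t0}"
    unfolding h_def using g branch_powr_analytic[OF T F] by (intro analytic_intros)
  then obtain d where d: "d > 0" "h holomorphic_on ball (of_real t0) d"
    by (auto simp: analytic_on_def)
  define r where "r = min d (min e R)"
  have r: "r > 0" using d e R by (simp add: r_def)
  define A where "A = complex_of_real ` {t \<in> segment_from t0 T. \<bar>t - t0\<bar> < r}"
  have "h w = 0" if "w \<in> ball (of_real t0) r" for w
  proof (rule analytic_continuation[of h "ball (of_real t0) r" A "of_real t0"])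
    show "h holomorphic_on ball (of_real t0) r"
      using d(2) by (rule holomorphic_on_subset) (auto simp: r_def)
    show "A \<subseteq> ball (of_real t0) r"
      by (auto simp: A_def dist_of_real dist_real_def)
    show "of_real t0 islimpt A"
      unfolding A_def by (rule start_islimpt[OF T r])
    show "h z = 0" if "z \<in> A" for z
      using that gval branch_powr_segment[OF T F] by (auto simp: A_def h_def r_def)
  qed (use r that in auto)
  then show ?thesis
    unfolding eventually_nhds_metric using r
    by (intro exI[of _ r]) (auto simp: h_def dist_commute)
qed

end

theory Submission
  imports Defs "HOL-Probability.Distributions" "HOL-Real_Asymp.Real_Asymp"
begin

unbundle no vec_syntax

text \<open>Put \<open>s = 1 / (exp \<phi> - 1)\<close>.  Then \<open>exp (- \<phi>) = s / (1 + s)\<close> and \<open>\<psi> = exp (- s)\<close>, so the integrand is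
  \<open>(s / (1 + s))^\<lambda> a(t)\<close>, and the functions of the expansion are
  \<open>\<Phi>(\<lambda>, z) = \<Gamma>(\<lambda> + 1) U(\<lambda> + 1, 2, z) = \<integral> exp (- z s) (s / (1 + s))^\<lambda> ds\<close> over \<open>s > 0\<close>, taken at
  \<open>z = \<chi>\<^sub>n\<close>.  They arise from a local expansion of \<open>a\<close>: the function \<open>v = \<psi>^(1 / \<beta>0)\<close> is an analytic
  coordinate at \<open>t0\<close>, in which \<open>a dt\<close> is \<open>v^\<alpha>0 \<Sum>\<^sub>n \<beta>0 d\<^sub>n v^n dv\<close>; since \<open>v = exp (- s / \<beta>0)\<close>, the
  term of index \<open>n\<close> is \<open>d\<^sub>n exp (- \<chi>\<^sub>n s) ds\<close> up to the orientation.  Lagrange inversion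
  (\<open>fps_lagrange_expansion\<close>) identifies \<open>d\<^sub>n\<close> with \<open>exp (\<i> \<omega>) c(n)\<close>.  The part of the segment away
  from \<open>t0\<close>, where \<open>\<phi>\<close> has a positive lower bound, and the cut-off parts of the integrals \<open>\<Phi>\<close> are
  \<open>O(exp (- c \<lambda>))\<close> for some \<open>c > 0\<close>.

  It remains to compare sizes.  The saddle-point asymptotics \<open>tricomi_Phi_asymp\<close> says that
  \<open>\<bar>\<Phi>(\<lambda>, z)\<bar>\<close> is comparable to \<open>\<lambda>^(1/4) exp (- 2 Re (sqrt z) sqrt \<lambda>)\<close>.  So the exponentially small
  errors are harmless, and every \<open>\<Phi>(\<lambda>, \<chi>\<^sub>n)\<close> with \<open>n \<ge> N\<close> is \<open>o(\<Phi>(\<lambda>, \<chi>\<^sub>N\<^sub>-\<^sub>1))\<close>.  If \<open>\<alpha>0\<close> is not real,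
  however, then \<open>\<Phi>(\<lambda>, \<chi>\<^sub>n)\<close> is smaller, by oscillation, than the integral of the absolute value,
  which decays like \<open>exp (- 2 sqrt (Re \<chi>\<^sub>n) sqrt \<lambda>)\<close>; a remainder estimated by absolute values right
  after \<open>N\<close> terms need not be small enough.  The local expansion is therefore taken up to some
  \<open>M \<ge> N\<close> with \<open>sqrt (M / \<beta>0) > Re (sqrt \<chi>\<^sub>N\<^sub>-\<^sub>1)\<close>: its remainder is
  \<open>O(exp (- 2 sqrt (M / \<beta>0) sqrt \<lambda>))\<close>, and the terms from \<open>N\<close> to \<open>M - 1\<close> are handled one by one.\<close>

section \<open>Integrals along rotated half-lines\<close>

lemma integral_FTC_open_interval:
  fixes F f :: "real \<Rightarrow> 'a::euclidean_space"
  assumes "a < b"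
    and "\<And>x. a < x \<Longrightarrow> x < b \<Longrightarrow> (F has_vector_derivative f x) (at x)"
    and "continuous_on {a<..<b} f" "set_integrable lborel {a<..<b} f"
    and "(F \<longlongrightarrow> A) (at_right a)" "(F \<longlongrightarrow> B) (at_left b)"
  shows "(LBINT x:{a<..<b}. f x) = B - A"
proof -
  have "(LBINT x=ereal a..ereal b. f x) = B - A"
    using assms
    by (intro interval_integral_FTC_integrable[where F=F])
       (auto simp: ereal_tendsto_simps continuous_on_eq_continuous_at)
  then show ?thesis
    using assms(1) by (simp add: interval_lebesgue_integral_def less_imp_le)
qed

lemma integral_FTC_half_line:
  fixes F f :: "real \<Rightarrow> 'a::euclidean_space"
  assumes "\<And>x. 0 < x \<Longrightarrow> (F has_vector_derivative f x) (at x)"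
    and "continuous_on {0<..} f" "set_integrable lborel {0<..} f"
    and "(F \<longlongrightarrow> A) (at_right 0)" "(F \<longlongrightarrow> B) at_top"
  shows "(LBINT x:{0<..}. f x) = B - A"
proof -
  have *: "einterval (ereal 0) \<infinity> = {0<..}"
    by (auto simp: einterval_def)
  have "(LBINT x=ereal 0..\<infinity>. f x) = B - A"
    using assms
    by (intro interval_integral_FTC_integrable[where F=F])
       (auto simp: ereal_tendsto_simps continuous_on_eq_continuous_at * simp del: zero_ereal_def[symmetric] ereal_eq_0)
  then show ?thesis
    unfolding interval_lebesgue_integral_def * by simp
qed

lemma set_integrable_exp_decay:
  assumes "d > 0"
  shows "set_integrable lborel {0<..} (\<lambda>r::real. exp (- d * r))"
proof -
  have "(\<lambda>r. exp (- d * r)) absolutely_integrable_on {0..}"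
    using has_integral_exp_minus_to_infinity[OF assms, of 0]
    by (intro nonnegative_absolutely_integrable_1) (auto simp: integrable_on_def)
  then have "set_integrable lebesgue {0<..} (\<lambda>r. exp (- d * r))"
    by (rule set_integrable_subset) auto
  then show ?thesis
    unfolding set_integrable_def
    by (subst (asm) integrable_completion) auto
qed

lemma set_integrable_lborel_bound:
  fixes g :: "real \<Rightarrow> 'a::euclidean_space" and f :: "real \<Rightarrow> real"
  assumes "set_integrable lborel A f" "A \<in> sets borel" "continuous_on A g"
    and "\<And>x. x \<in> A \<Longrightarrow> norm (g x) \<le> f x"
  shows "set_integrable lborel A g"
proof (rule set_integrable_bound[OF assms(1)])
  show "set_borel_measurable lborel A g"
    unfolding set_borel_measurable_def
    using borel_measurable_continuous_on_indicator[OF assms(2,3)] by simp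
  show "AE x in lborel. x \<in> A \<longrightarrow> norm (g x) \<le> norm (f x)"
    using assms(4) by (intro AE_I2) (auto intro: order_trans abs_ge_self)
qed

text \<open>A primitive \<open>F\<close> of \<open>f\<close> on the right half-plane turns the claim into one about
  \<open>F(r c) - F(r)\<close>.  Its derivative in \<open>r\<close> is the difference of the two integrands, and it vanishes
  at both ends of the half-line, because it is an integral of \<open>f\<close> over a segment of length
  \<open>\<bar>c - 1\<bar> r\<close> on which \<open>f\<close> is at most \<open>M exp (- d r)\<close>.\<close>

lemma rotate_half_line:
  fixes f :: "complex \<Rightarrow> complex" and c :: complex
  assumes f: "f holomorphic_on {s. Re s > 0}" and c: "Re c > 0" and d: "d > 0"
    and bound: "\<And>r \<tau>. r > 0 \<Longrightarrow> \<tau> \<in> {0..1} \<Longrightarrow>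
      norm (f (of_real r * (of_real (1 - \<tau>) + of_real \<tau> * c))) \<le> M * exp (- d * r)"
  shows "(LBINT r:{0<..}. f (of_real r)) = c * (LBINT r:{0<..}. f (of_real r * c))"
proof -
  let ?H = "{s. Re s > 0}"
  have H: "convex ?H" "open ?H"
    by (simp_all add: convex_halfspace_Re_gt open_halfspace_Re_gt)
  obtain F where F: "\<And>x. x \<in> ?H \<Longrightarrow> (F has_field_derivative f x) (at x within ?H)"
    by (rule holomorphic_convex_primitive'[OF H f]) blast
  have F': "(F has_field_derivative f x) (at x)" if "Re x > 0" for x
  proof -
    have x: "x \<in> ?H" using that by simp
    show ?thesis using F[OF x] unfolding at_within_open[OF x H(2)] .
  qed
  have cf: "continuous_on ?H f"
    using f by (rule holomorphic_on_imp_continuous_on)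
  have Mr: "set_integrable lborel {0<..} (\<lambda>r::real. M * exp (- d * r))"
    using set_integrable_exp_decay[OF d] by simp
  have b1: "norm (f (of_real r)) \<le> M * exp (- d * r)" if "r > 0" for r
    using bound[OF that, of 0] by simp
  have b2: "norm (f (of_real r * c)) \<le> M * exp (- d * r)" if "r > 0" for r
    using bound[OF that, of 1] by simp
  have c1: "continuous_on {0<..} (\<lambda>r. f (of_real r))"
    by (rule continuous_on_compose2[OF cf]) (auto intro!: continuous_intros)
  have c2: "continuous_on {0<..} (\<lambda>r. f (of_real r * c))"
    by (rule continuous_on_compose2[OF cf]) (use c in \<open>auto intro!: continuous_intros\<close>)
  have i1: "set_integrable lborel {0<..} (\<lambda>r. f (of_real r))"
    by (rule set_integrable_lborel_bound[OF Mr _ c1 b1]) auto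
  have i2: "set_integrable lborel {0<..} (\<lambda>r. f (of_real r * c))"
    by (rule set_integrable_lborel_bound[OF Mr _ c2 b2]) auto
  define D where "D = (\<lambda>r. F (of_real r * c) - F (of_real r))"
  have D: "norm (D r) \<le> M * exp (- d * r) * (norm (c - 1) * r)" if r: "r > 0" for r
  proof -
    have "norm (F (of_real r * c) - F (of_real r)) \<le> (M * exp (- d * r)) * norm (of_real r * c - of_real r)"
    proof (rule field_differentiable_bound[where S = "closed_segment (of_real r) (of_real r * c)"])
      fix z assume "z \<in> closed_segment (of_real r) (of_real r * c)"
      then obtain u where u: "0 \<le> u" "u \<le> 1"
        and z: "z = (1 - u) *\<^sub>R of_real r + u *\<^sub>R (of_real r * c)"
        by (auto simp: closed_segment_def)
      have z: "z = of_real r * (of_real (1 - u) + of_real u * c)"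
        unfolding z by (simp add: scaleR_conv_of_real algebra_simps)
      show "norm (f z) \<le> M * exp (- d * r)"
        unfolding z using bound[OF r, of u] u by simp
      have "(1 - u) + u * Re c > 0"
        using c u by (cases "u = 1") (auto intro: add_pos_nonneg)
      then have "Re z > 0" using r by (simp add: z)
      then show "(F has_field_derivative f z) (at z within closed_segment (of_real r) (of_real r * c))"
        by (rule has_field_derivative_at_within[OF F'])
    qed auto
    also have "norm (of_real r * c - of_real r) = norm (c - 1) * r"
    proof -
      have "of_real r * c - of_real r = (c - 1) * of_real r" by (simp add: algebra_simps)
      then show ?thesis using r by (simp add: norm_mult)
    qed
    finally show ?thesis by (simp add: D_def)
  qed
  have lim0: "(D \<longlongrightarrow> 0) (at_right 0)"
  proof (rule Lim_null_comparison)
    show "\<forall>\<^sub>F r in at_right 0. norm (D r) \<le> M * exp (- d * r) * (norm (c - 1) * r)"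
      unfolding eventually_at_filter using D by (intro always_eventually) auto
    have "((\<lambda>r. M * exp (- d * r) * (norm (c - 1) * r)) \<longlongrightarrow> M * exp (- d * 0) * (norm (c - 1) * 0)) (at_right 0)"
      by (intro tendsto_intros)
    then show "((\<lambda>r. M * exp (- d * r) * (norm (c - 1) * r)) \<longlongrightarrow> 0) (at_right 0)" by simp
  qed
  have liminf: "(D \<longlongrightarrow> 0) at_top"
  proof (rule Lim_null_comparison)
    show "\<forall>\<^sub>F r in at_top. norm (D r) \<le> M * exp (- d * r) * (norm (c - 1) * r)"
      using eventually_gt_at_top[of 0] by eventually_elim (rule D)
    have "((\<lambda>r. exp (- d * r) * r) \<longlongrightarrow> 0) at_top"
      using d by real_asymp
    then have "((\<lambda>r. (M * norm (c - 1)) * (exp (- d * r) * r)) \<longlongrightarrow> 0) at_top"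
      by (rule tendsto_mult_right_zero)
    then show "((\<lambda>r. M * exp (- d * r) * (norm (c - 1) * r)) \<longlongrightarrow> 0) at_top"
      by (simp add: mult_ac)
  qed
  have "(LBINT r:{0<..}. c * f (of_real r * c) - f (of_real r)) = 0 - 0"
  proof (rule integral_FTC_half_line[OF _ _ _ lim0 liminf])
    fix r :: real assume r: "r > 0"
    have "((\<lambda>r. F (of_real r * c)) has_vector_derivative c * f (of_real r * c)) (at r)"
    proof -
      have "((\<lambda>r. of_real r * c) has_vector_derivative c) (at r)"
        by (auto intro!: derivative_eq_intros simp: has_vector_derivative_def scaleR_conv_of_real)
      moreover have "(F has_field_derivative f (of_real r * c)) (at (of_real r * c))"
        using r c by (intro F') simp
      ultimately show ?thesis
        by (rule field_vector_diff_chain_at[unfolded o_def])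
    qed
    moreover have "((\<lambda>r. F (of_real r)) has_vector_derivative f (of_real r)) (at r)"
    proof -
      have "(complex_of_real has_vector_derivative 1) (at r)"
        by (auto intro!: derivative_eq_intros simp: has_vector_derivative_def scaleR_conv_of_real)
      moreover have "(F has_field_derivative f (of_real r)) (at (of_real r))"
        using r by (intro F') simp
      ultimately have "((\<lambda>r. F (of_real r)) has_vector_derivative 1 * f (of_real r)) (at r)"
        by (rule field_vector_diff_chain_at[unfolded o_def])
      then show ?thesis by simp
    qed
    ultimately show "(D has_vector_derivative c * f (of_real r * c) - f (of_real r)) (at r)"
      unfolding D_def by (rule has_vector_derivative_diff)
  qed (use c1 c2 i1 i2 in \<open>auto intro!: continuous_intros set_integral_diff\<close>)
  then show ?thesis
    using i1 i2 by simp
qed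

lemma Re_csqrt_pos: "Re z > 0 \<Longrightarrow> Re (csqrt z) > 0"
  by (simp add: add_nonneg_pos)

text \<open>Rotating the real Gaussian integral by \<open>csqrt z\<close>: as \<open>Re z > 0\<close>, the square of every point of
  the sector swept by the rotation has positive real part.\<close>

lemma complex_gaussian_integral:
  assumes "Re z > 0"
  shows "has_bochner_integral lborel (\<lambda>y::real. exp (- (z * of_real (y\<^sup>2)))) (of_real (sqrt pi) / csqrt z)"
proof -
  define c where "c = csqrt z"
  have c2: "c\<^sup>2 = z" and c: "Re c > 0" and c0: "c \<noteq> 0"
    using assms Re_csqrt_pos[OF assms] by (auto simp: c_def)
  define d where "d = min (1/2) (Re z) / 2"
  have d: "d > 0" using assms by (simp add: d_def)
  have r0: "(LBINT r:{0<..}. exp (- (complex_of_real r)\<^sup>2)) = of_real (sqrt pi / 2)"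
  proof -
    have "(LBINT r:{0<..}. exp (- (complex_of_real r)\<^sup>2)) = (LBINT r:{0<..}. complex_of_real (exp (- r\<^sup>2)))"
      by (simp flip: exp_of_real)
    also have "\<dots> = of_real (LBINT r:{0<..}. exp (- r\<^sup>2))"
      by (rule set_integral_complex_of_real)
    also have "(LBINT r:{0<..}. exp (- r\<^sup>2)) = (LBINT r:{0..}. exp (- r\<^sup>2 :: real))"
      by (rule set_integral_discrete_difference[of "{0}"]) auto
    also have "\<dots> = sqrt pi / 2"
      using has_bochner_integral_integral_eq[OF gaussian_moment_0]
      by (simp add: set_lebesgue_integral_def)
    finally show ?thesis .
  qed
  have "(LBINT r:{0<..}. exp (- (complex_of_real r)\<^sup>2))
      = c * (LBINT r:{0<..}. exp (- (complex_of_real r * c)\<^sup>2))"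
  proof (rule rotate_half_line[where d = d and M = "exp d"])
    fix r \<tau> :: real assume r: "r > 0" and t: "\<tau> \<in> {0..1}"
    define w where "w = of_real (1 - \<tau>) + of_real \<tau> * c"
    have "Re (w\<^sup>2) = (1 - \<tau>)\<^sup>2 + 2 * ((1 - \<tau>) * \<tau> * Re c) + \<tau>\<^sup>2 * Re z"
      unfolding w_def c2[symmetric] by (simp add: power2_eq_square algebra_simps)
    also have "\<dots> \<ge> (1 - \<tau>)\<^sup>2 * min (1/2) (Re z) + \<tau>\<^sup>2 * min (1/2) (Re z)"
    proof -
      have "(1 - \<tau>)\<^sup>2 * min (1/2) (Re z) \<le> (1 - \<tau>)\<^sup>2 * 1" by (intro mult_left_mono) auto
      moreover have "\<tau>\<^sup>2 * min (1/2) (Re z) \<le> \<tau>\<^sup>2 * Re z" by (intro mult_left_mono) auto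
      moreover have "(1 - \<tau>) * \<tau> * Re c \<ge> 0" using t c by simp
      ultimately show ?thesis by simp
    qed
    also have "(1 - \<tau>)\<^sup>2 * min (1/2) (Re z) + \<tau>\<^sup>2 * min (1/2) (Re z) = ((1 - \<tau>)\<^sup>2 + \<tau>\<^sup>2) * (2 * d)"
      by (simp add: d_def algebra_simps)
    also have "\<dots> \<ge> (1/2) * (2 * d)"
    proof (rule mult_right_mono)
      have "0 \<le> (2 * \<tau> - 1)\<^sup>2" by simp
      then show "1 / 2 \<le> (1 - \<tau>)\<^sup>2 + \<tau>\<^sup>2" by (simp add: power2_eq_square algebra_simps)
    qed (use d in simp)
    finally have w: "Re (w\<^sup>2) \<ge> d" by simp
    have "d * r - d \<le> r\<^sup>2 * d"
    proof -
      have "0 \<le> (r - 1)\<^sup>2 + r" using r by simp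
      then have "r - 1 \<le> r\<^sup>2" by (simp add: power2_eq_square algebra_simps)
      then show ?thesis using d mult_right_mono[of "r - 1" "r\<^sup>2" d] by (simp add: algebra_simps)
    qed
    also have "\<dots> \<le> r\<^sup>2 * Re (w\<^sup>2)" using w by (intro mult_left_mono) auto
    also have "\<dots> = Re ((of_real r * w)\<^sup>2)"
      by (simp add: power_mult_distrib flip: of_real_power)
    finally show "norm (exp (- (complex_of_real r * (of_real (1 - \<tau>) + of_real \<tau> * c))\<^sup>2)) \<le> exp d * exp (- d * r)"
      unfolding w_def[symmetric] by (simp add: exp_add[symmetric])
  qed (use c d in \<open>auto intro!: holomorphic_intros\<close>)
  then have half: "(LBINT r:{0<..}. exp (- (z * of_real (r\<^sup>2)))) = of_real (sqrt pi / 2) / c"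
    unfolding r0 using c0 by (simp add: power_mult_distrib c2 mult_ac field_simps)
  have int: "set_integrable lborel {0<..} (\<lambda>r. exp (- (z * of_real (r\<^sup>2))))"
  proof (rule set_integrable_lborel_bound[where f = "\<lambda>r. exp (Re z) * exp (- Re z * r)"])
    show "set_integrable lborel {0<..} (\<lambda>r. exp (Re z) * exp (- Re z * r))"
      using set_integrable_exp_decay[OF assms] by simp
    fix r :: real assume "r \<in> {0<..}"
    then have "0 \<le> (r - 1)\<^sup>2 + r" by simp
    then have "r - 1 \<le> r\<^sup>2" by (simp add: power2_eq_square algebra_simps)
    then have "Re z * (r - 1) \<le> Re z * r\<^sup>2" using assms by simp
    then show "norm (exp (- (z * of_real (r\<^sup>2)))) \<le> exp (Re z) * exp (- Re z * r)"
      by (simp add: exp_add[symmetric] algebra_simps flip: of_real_power)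
  qed (auto intro!: continuous_intros)
  have "has_bochner_integral lborel (\<lambda>y. indicator {0<..} y *\<^sub>R exp (- (z * of_real (y\<^sup>2)))) (of_real (sqrt pi / 2) / c)"
    using int half unfolding set_integrable_def set_lebesgue_integral_def has_bochner_integral_iff by simp
  then have "has_bochner_integral lborel (\<lambda>y. indicator {0..} y *\<^sub>R exp (- (z * of_real (y\<^sup>2)))) (of_real (sqrt pi / 2) / c)"
    by (subst has_bochner_integral_discrete_difference[where X = "{0}", of _ _ "\<lambda>y. indicator {0<..} y *\<^sub>R exp (- (z * of_real (y\<^sup>2)))"])
       (auto simp: indicator_def)
  from has_bochner_integral_even_function[OF this] show ?thesis
    by (simp add: c_def scaleR_conv_of_real)
qed

section \<open>Asymptotics of the Tricomi functions\<close>

definition tricomi_integrand :: "real \<Rightarrow> complex \<Rightarrow> real \<Rightarrow> complex" where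
  "tricomi_integrand x z s = exp (- (z * of_real s)) * of_real ((s / (1 + s)) powr x)"

text \<open>This is \<open>\<Gamma>(x + 1) U(x + 1, 2, z)\<close>; the normalising factor cancels the \<open>1 / \<Gamma>\<close> in front of
  the integral for \<open>U\<close>.\<close>

definition tricomi_Phi :: "real \<Rightarrow> complex \<Rightarrow> complex" where
  "tricomi_Phi x z = (LBINT s:{0<..}. tricomi_integrand x z s)"

lemma Gamma_mult_tricomi_U:
  assumes "x \<ge> 0"
  shows "Gamma (of_real x + 1) * tricomi_U (of_real x + 1) 2 z = tricomi_Phi x z"
proof -
  have "Gamma (x + 1) > 0" using assms by (intro Gamma_real_pos) simp
  then have "Gamma (complex_of_real (x + 1)) \<noteq> 0"
    unfolding Gamma_complex_of_real by (metis less_irrefl of_real_eq_0_iff)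
  then have g: "Gamma (complex_of_real x + 1) \<noteq> 0" by simp
  have e: "of_real t powr (of_real x + 1 - 1) * complex_of_real (1 + t) powr (2 - (of_real x + 1) - 1)
      = of_real ((t / (1 + t)) powr x)" if "t > 0" for t
  proof -
    have e1: "complex_of_real x + 1 - 1 = of_real x" "2 - (complex_of_real x + 1) - 1 = of_real (- x)"
      by simp_all
    show ?thesis
      unfolding e1 using that
      by (simp add: powr_of_real powr_divide powr_minus_divide del: of_real_add of_real_minus)
  qed
  have "tricomi_Phi x z = (LBINT t:{0<..}. exp (- (z * of_real t)) * of_real t powr (of_real x + 1 - 1) *
                      of_real (1 + t) powr (2 - (of_real x + 1) - 1))"
    unfolding tricomi_Phi_def tricomi_integrand_def using e
    by (intro set_lebesgue_integral_cong) (auto simp: mult.assoc)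
  then show ?thesis using g by (simp add: tricomi_U_def)
qed

lemma Re_Ln_1_plus_ge:
  assumes "Re w > 0"
  shows "Re (Ln (1 + w)) \<ge> ln (1 + Re w)"
proof -
  have "1 + Re w \<le> norm (1 + w)" using complex_Re_le_cmod[of "1 + w"] by simp
  moreover have "1 + w \<noteq> 0" using assms by (auto simp: complex_eq_iff)
  ultimately show ?thesis using assms by (simp add: ln_mono)
qed

text \<open>Rotation onto the ray through \<open>1 / \<zeta>\<close> with \<open>\<zeta> = csqrt z\<close>.  For large \<open>x\<close>
  the saddle point of \<open>- z s - x Ln (1 + 1 / s)\<close> in the right half-plane is close to
  \<open>sqrt x / \<zeta>\<close>, a point of this ray.\<close>

lemma tricomi_Phi_rotated:
  assumes l: "x \<ge> 0" and z: "Re z > 0"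
  defines "\<zeta> \<equiv> csqrt z"
  shows "tricomi_Phi x z =
    1 / \<zeta> * (LBINT r:{0<..}. exp (- (\<zeta> * of_real r) - of_real x * Ln (1 + \<zeta> / of_real r)))"
proof -
  define f where "f = (\<lambda>s. exp (- (z * s) - of_real x * Ln (1 + 1 / s)))"
  have \<zeta>2: "\<zeta> * \<zeta> = z" using power2_csqrt[of z] by (simp add: \<zeta>_def power2_eq_square)
  have \<zeta>: "Re \<zeta> > 0" "\<zeta> \<noteq> 0" using Re_csqrt_pos[OF z] by (auto simp: \<zeta>_def)
  \<comment> \<open>On the sector \<open>Re (z s)\<close> interpolates between \<open>r Re z\<close> and \<open>r Re \<zeta>\<close>, as \<open>z (1 / \<zeta>) = \<zeta>\<close>.\<close>
  define d where "d = min (Re z) (Re \<zeta>)"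
  have d: "d > 0" using z \<zeta> by (simp add: d_def)
  have inv: "Re (1 / s) > 0" if "Re s > 0" for s
    using that by (simp add: Re_divide add_pos_nonneg)
  have "tricomi_Phi x z = (LBINT r:{0<..}. f (of_real r))"
    unfolding tricomi_Phi_def tricomi_integrand_def
  proof (intro set_lebesgue_integral_cong allI impI)
    fix s :: real assume s: "s \<in> {0<..}"
    have "Ln (1 + 1 / of_real s) = Ln (of_real (1 + 1 / s))" by simp
    also have "\<dots> = of_real (ln (1 + 1 / s))"
      using s by (intro Ln_of_real) (auto intro: add_pos_pos)
    also have "ln (1 + 1 / s) = - ln (s / (1 + s))"
      using s by (simp add: ln_div field_simps)
    finally have L: "Ln (1 + 1 / of_real s) = - of_real (ln (s / (1 + s)))" by simp
    have "(s / (1 + s)) powr x = exp (x * ln (s / (1 + s)))"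
      using s by (simp add: powr_def)
    then have P: "complex_of_real ((s / (1 + s)) powr x) = exp (of_real (x * ln (s / (1 + s))))"
      by (simp only: exp_of_real)
    show "exp (- (z * of_real s)) * of_real ((s / (1 + s)) powr x) = f (of_real s)"
      unfolding f_def L P by (simp add: exp_add[symmetric])
  qed auto
  also have "\<dots> = 1 / \<zeta> * (LBINT r:{0<..}. f (of_real r * (1 / \<zeta>)))"
  proof (rule rotate_half_line[OF _ _ d, where M = 1])
    have "1 + 1 / s \<notin> \<real>\<^sub>\<le>\<^sub>0" if "Re s > 0" for s
      using inv[OF that] by (auto simp: complex_nonpos_Reals_iff)
    then show "f holomorphic_on {s. Re s > 0}"
      unfolding f_def by (intro holomorphic_intros) auto
    show "Re (1 / \<zeta>) > 0" by (rule inv) fact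
    fix r \<tau> :: real assume r: "r > 0" and t: "\<tau> \<in> {0..1}"
    define s where "s = of_real r * (of_real (1 - \<tau>) + of_real \<tau> * (1 / \<zeta>))"
    define v where "v = 1 / \<zeta>"
    have "(1 - \<tau>) + \<tau> * Re v > 0"
      using inv[OF \<zeta>(1)] t by (cases "\<tau> = 1") (auto intro: add_pos_nonneg simp flip: v_def)
    then have "Re s > 0" using r unfolding s_def v_def[symmetric] by simp
    then have "Re (Ln (1 + 1 / s)) \<ge> 0"
      using Re_Ln_1_plus_ge[OF inv, of s] ln_ge_zero[of "1 + Re (1 / s)"] inv[of s] by linarith
    then have ln: "x * Re (Ln (1 + 1 / s)) \<ge> 0" using l by simp
    have "z * s = of_real r * (of_real (1 - \<tau>) * z + of_real \<tau> * \<zeta>)"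
      using \<zeta>(2) unfolding s_def \<zeta>2[symmetric] by (simp add: field_simps)
    then have "Re (z * s) = r * ((1 - \<tau>) * Re z + \<tau> * Re \<zeta>)" by simp
    also have "\<dots> \<ge> r * ((1 - \<tau>) * d + \<tau> * d)"
      using r t by (intro mult_left_mono add_mono) (auto simp: d_def)
    finally have "Re (z * s) \<ge> d * r" by (simp add: algebra_simps)
    then show "norm (f (of_real r * (of_real (1 - \<tau>) + of_real \<tau> * (1 / \<zeta>)))) \<le> 1 * exp (- d * r)"
      unfolding s_def[symmetric] f_def using ln by simp
  qed
  also have "(LBINT r:{0<..}. f (of_real r * (1 / \<zeta>)))
      = (LBINT r:{0<..}. exp (- (\<zeta> * of_real r) - of_real x * Ln (1 + \<zeta> / of_real r)))"
  proof (intro set_lebesgue_integral_cong allI impI)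
    fix r :: real
    have "z * (of_real r * (1 / \<zeta>)) = \<zeta> * of_real r"
      using \<zeta>(2) unfolding \<zeta>2[symmetric] by simp
    then show "f (of_real r * (1 / \<zeta>)) = exp (- (\<zeta> * of_real r) - of_real x * Ln (1 + \<zeta> / of_real r))"
      by (simp add: f_def)
  qed auto
  finally show ?thesis .
qed

lemma Ln_1_plus_quadratic:
  "((\<lambda>w. (Ln (1 + w) - w) / w\<^sup>2) \<longlongrightarrow> - 1 / 2) (at 0)"
proof -
  have "((\<lambda>w. (Ln (1 + w) - w) / w\<^sup>2) \<longlongrightarrow> (\<lambda>n. (-1) ^ Suc n / of_nat (n + 2)) 0) (at 0)"
  proof (rule powser_limit_0_strong[of 1])
    fix w :: complex assume w: "w \<noteq> 0" "norm w < 1"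
    have "(\<lambda>n. (-1) ^ Suc (n + 2) / of_nat (n + 2) * w ^ (n + 2)) sums
        (Ln (1 + w) - (\<Sum>n<2. (-1) ^ Suc n / of_nat n * w ^ n))"
      by (rule sums_split_initial_segment[OF Ln_series[OF w(2)]])
    then have "(\<lambda>n. (-1) ^ Suc (n + 2) / of_nat (n + 2) * w ^ (n + 2) / w\<^sup>2) sums ((Ln (1 + w) - w) / w\<^sup>2)"
      by (intro sums_divide) (simp add: numeral_2_eq_2)
    then show "(\<lambda>n. (-1) ^ Suc n / of_nat (n + 2) * w ^ n) sums ((Ln (1 + w) - w) / w\<^sup>2)"
      using w(1) by (simp add: power_add power2_eq_square)
  qed auto
  then show ?thesis by simp
qed

text \<open>With \<open>x = k\<^sup>4\<close> the rotated integrand is \<open>exp (- \<zeta> r - k\<^sup>4 Ln (1 + \<zeta> / r))\<close>; for large \<open>k\<close> its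
  saddle point is near \<open>r = k\<^sup>2\<close>, where the exponent is about \<open>- 2 \<zeta> k\<^sup>2\<close>, and its width is of
  order \<open>k\<close>.  Hence the substitution \<open>r = k (k + y)\<close> and the added term \<open>2 \<zeta> k\<^sup>2\<close>.\<close>

definition saddle_exponent :: "complex \<Rightarrow> real \<Rightarrow> real \<Rightarrow> complex" where
  "saddle_exponent \<zeta> k y = 2 * \<zeta> * of_real (k\<^sup>2) - \<zeta> * of_real (k * (k + y))
     - of_real (k ^ 4) * Ln (1 + \<zeta> / of_real (k * (k + y)))"

text \<open>The terms of first order in \<open>w\<close> combine to \<open>\<zeta>\<close> times
  \<open>2 k\<^sup>2 - k (k + y) - k\<^sup>3 / (k + y) = - k y\<^sup>2 / (k + y)\<close>, which tends to \<open>- y\<^sup>2\<close>.\<close>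

lemma saddle_exponent_eq:
  fixes \<zeta> :: complex
  assumes "k > 0" "k + y > 0"
  defines "w \<equiv> \<zeta> / of_real (k * (k + y))"
  shows "saddle_exponent \<zeta> k y =
    - (\<zeta> * of_real (k * y\<^sup>2 / (k + y))) - of_real (k ^ 4) * (Ln (1 + w) - w)"
proof -
  have "k ^ 4 / (k * (k + y)) = k ^ 3 / (k + y)"
  proof -
    have "k ^ 4 = k * k ^ 3" by (simp add: power3_eq_cube power4_eq_xxxx)
    then show ?thesis using assms(1) by (simp add: mult_divide_mult_cancel_left)
  qed
  then have "of_real (k ^ 4) * w = \<zeta> * of_real (k ^ 3 / (k + y))"
    unfolding w_def by (metis (no_types, lifting) of_real_divide times_divide_eq_right mult.commute times_divide_eq_left)
  moreover have "2 * k\<^sup>2 - k * (k + y) - k ^ 3 / (k + y) = - (k * y\<^sup>2 / (k + y))"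
    using assms by (simp add: field_simps power2_eq_square power3_eq_cube)
  then have "\<zeta> * of_real (2 * k\<^sup>2 - k * (k + y) - k ^ 3 / (k + y)) = \<zeta> * of_real (- (k * y\<^sup>2 / (k + y)))"
    by (simp only:)
  ultimately show ?thesis
    unfolding saddle_exponent_def w_def[symmetric]
    by (simp add: algebra_simps del: of_real_divide)
qed

text \<open>The correction \<open>\<zeta>\<^sup>2 / 2\<close> is the second-order term of the logarithm: \<open>Ln (1 + w) - w\<close> is about
  \<open>- w\<^sup>2 / 2\<close>, and \<open>k\<^sup>4 w\<^sup>2\<close> tends to \<open>\<zeta>\<^sup>2\<close>.\<close>

lemma saddle_exponent_tendsto:
  assumes "\<zeta> \<noteq> 0"
  shows "((\<lambda>k. saddle_exponent \<zeta> k y) \<longlongrightarrow> - (\<zeta> * of_real (y\<^sup>2)) + \<zeta>\<^sup>2 / 2) at_top"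
proof -
  define w where "w = (\<lambda>k. \<zeta> / of_real (k * (k + y)))"
  have ev: "eventually (\<lambda>k. k > 0 \<and> k + y > 0) at_top"
    by (intro eventually_conj eventually_gt_at_top) 
       (use eventually_gt_at_top[of "- y"] in \<open>eventually_elim, auto\<close>)
  have w0: "(w \<longlongrightarrow> 0) at_top"
  proof -
    have "((\<lambda>k::real. 1 / (k * (k + y))) \<longlongrightarrow> 0) at_top" by real_asymp
    then have "((\<lambda>k. \<zeta> * of_real (1 / (k * (k + y)))) \<longlongrightarrow> \<zeta> * of_real 0) at_top"
      by (intro tendsto_intros)
    then show ?thesis by (simp add: w_def)
  qed
  have "filterlim w (at 0) at_top"
    unfolding filterlim_at using w0 ev assms
    by (auto simp: w_def simp flip: of_real_add elim!: eventually_mono)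
  then have l1: "((\<lambda>k. (Ln (1 + w k) - w k) / (w k)\<^sup>2) \<longlongrightarrow> - 1 / 2) at_top"
    by (rule filterlim_compose[OF Ln_1_plus_quadratic])
  have r1: "((\<lambda>k::real. (k / (k + y))\<^sup>2) \<longlongrightarrow> 1) at_top" by real_asymp
  have r2: "((\<lambda>k::real. k * y\<^sup>2 / (k + y)) \<longlongrightarrow> y\<^sup>2) at_top" by real_asymp
  have "((\<lambda>k. - (\<zeta> * of_real (k * y\<^sup>2 / (k + y)))
        - \<zeta>\<^sup>2 * of_real ((k / (k + y))\<^sup>2) * ((Ln (1 + w k) - w k) / (w k)\<^sup>2))
      \<longlongrightarrow> - (\<zeta> * of_real (y\<^sup>2)) - \<zeta>\<^sup>2 * of_real 1 * (- 1 / 2)) at_top"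
    by (intro tendsto_intros r1 r2 l1)
  moreover have "eventually (\<lambda>k. - (\<zeta> * of_real (k * y\<^sup>2 / (k + y)))
        - \<zeta>\<^sup>2 * of_real ((k / (k + y))\<^sup>2) * ((Ln (1 + w k) - w k) / (w k)\<^sup>2) = saddle_exponent \<zeta> k y) at_top"
    using ev
  proof eventually_elim
    case (elim k)
    have "(k * (k + y))\<^sup>2 * (k / (k + y))\<^sup>2 = k ^ 4"
    proof -
      have "(k * (k + y))\<^sup>2 * (k / (k + y))\<^sup>2 = ((k * (k + y)) * (k / (k + y)))\<^sup>2"
        by (simp only: power_mult_distrib)
      also have "(k * (k + y)) * (k / (k + y)) = k * k" using elim by simp
      also have "(k * k)\<^sup>2 = k ^ 4" by (simp add: power2_eq_square power4_eq_xxxx)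
      finally show ?thesis .
    qed
    then have "of_real (k ^ 4) * (w k)\<^sup>2 = \<zeta>\<^sup>2 * complex_of_real ((k / (k + y))\<^sup>2)"
    proof -
      assume *: "(k * (k + y))\<^sup>2 * (k / (k + y))\<^sup>2 = k ^ 4"
      define K where "K = complex_of_real (k * (k + y))"
      have "K \<noteq> 0" using elim by (simp add: K_def del: of_real_mult of_real_add)
      moreover have "of_real (k ^ 4) = K\<^sup>2 * complex_of_real ((k / (k + y))\<^sup>2)"
        unfolding *[symmetric] K_def by simp
      ultimately show ?thesis
        unfolding w_def K_def[symmetric] by (simp add: power_divide)
    qed
    moreover have "w k \<noteq> 0" using elim assms by (auto simp: w_def simp flip: of_real_add)
    ultimately have "\<zeta>\<^sup>2 * complex_of_real ((k / (k + y))\<^sup>2) * ((Ln (1 + w k) - w k) / (w k)\<^sup>2)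
        = of_real (k ^ 4) * (Ln (1 + w k) - w k)"
      by (metis (no_types, lifting) mult.assoc nonzero_mult_div_cancel_left power_not_zero times_divide_eq_right)
    moreover have "saddle_exponent \<zeta> k y = - (\<zeta> * of_real (k * y\<^sup>2 / (k + y))) - of_real (k ^ 4) * (Ln (1 + w k) - w k)"
      unfolding w_def by (rule saddle_exponent_eq) (use elim in auto)
    ultimately show ?case by simp
  qed
  ultimately show ?thesis
    by (simp add: tendsto_cong)
qed

text \<open>A majorant uniform in \<open>k\<close>, for dominated convergence.  If \<open>k + y \<ge> k / 2\<close>, then \<open>w\<close> is at
  most of order \<open>k^(- 2)\<close>, so that \<open>k\<^sup>4 (Ln (1 + w) - w)\<close> is bounded, and \<open>k y\<^sup>2 / (k + y) \<ge> \<bar>y\<bar> - 1\<close>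
  gives the decay.  If \<open>k + y < k / 2\<close>, then \<open>w\<close> may be large; there
  \<open>ln \<bar>1 + w\<bar> \<ge> ln (1 + Re w) \<ge> Re w / (1 + Re w)\<close> suffices, because such points are far from the
  saddle point and a margin of \<open>Re \<zeta> k\<^sup>2 / 12\<close> is left up to a constant, while \<open>\<bar>y\<bar> \<le> k\<close>.\<close>

lemma saddle_exponent_bound:
  assumes a: "Re \<zeta> > 0" and k: "k \<ge> 1" "k\<^sup>2 \<ge> 4 * norm \<zeta>" and y: "k + y > 0"
  shows "Re (saddle_exponent \<zeta> k y) \<le> 8 * (norm \<zeta>)\<^sup>2 + (Re \<zeta>)\<^sup>2 + Re \<zeta> - Re \<zeta> / 6 * \<bar>y\<bar>"
proof -
  define a where "a = Re \<zeta>"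
  have a: "a > 0" using assms by (simp add: a_def)
  have an: "a \<le> norm \<zeta>" unfolding a_def by (rule complex_Re_le_cmod)
  define w where "w = \<zeta> / of_real (k * (k + y))"
  have ky: "k * (k + y) > 0" using k y by simp
  show ?thesis
  proof (cases "k + y \<ge> k / 2")
    case True
    have "k * (k + y) \<ge> k\<^sup>2 / 2"
      using mult_left_mono[OF True, of k] k by (simp add: power2_eq_square)
    then have "norm w \<le> norm \<zeta> / (k\<^sup>2 / 2)"
    proof -
      have "norm w = norm \<zeta> / (k * (k + y))"
        unfolding w_def using ky by (simp only: norm_divide norm_of_real abs_of_pos)
      then show ?thesis using \<open>k * (k + y) \<ge> k\<^sup>2 / 2\<close> k y
        by (simp only:) (intro divide_left_mono mult_pos_pos, auto)
    qed
    also have "\<dots> = 2 * norm \<zeta> / k\<^sup>2" by simp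
    finally have nw: "norm w \<le> 2 * norm \<zeta> / k\<^sup>2" .
    have "2 * norm \<zeta> / k\<^sup>2 \<le> 1 / 2" using k by (simp add: field_simps)
    then have w12: "norm w \<le> 1 / 2" using nw by linarith
    have "norm (Ln (1 + w) - w) \<le> (norm w)\<^sup>2 / (1 - norm w)"
      using w12 by (intro Ln_approx_linear) linarith
    also have "\<dots> \<le> (norm w)\<^sup>2 / (1/2)"
      using w12 by (intro divide_left_mono) auto
    also have "\<dots> \<le> 2 * (2 * norm \<zeta> / k\<^sup>2)\<^sup>2"
      using power_mono[OF nw, of 2] by simp
    finally have "k ^ 4 * norm (Ln (1 + w) - w) \<le> k ^ 4 * (2 * (2 * norm \<zeta> / k\<^sup>2)\<^sup>2)"
      by (intro mult_left_mono) auto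
    also have "\<dots> = 8 * (norm \<zeta>)\<^sup>2"
      using k by (simp add: power_divide power_mult_distrib field_simps)
    finally have L: "- Re (of_real (k ^ 4) * (Ln (1 + w) - w)) \<le> 8 * (norm \<zeta>)\<^sup>2"
      using abs_Re_le_cmod[of "of_real (k ^ 4) * (Ln (1 + w) - w)"] by (simp add: norm_mult norm_power)
    have "(\<bar>y\<bar> - 1) * (k + y) \<le> k * y\<^sup>2"
    proof -
      show ?thesis
      proof (cases "\<bar>y\<bar> \<le> 1")
        case True
        then have "(\<bar>y\<bar> - 1) * (k + y) \<le> 0" using y by (simp add: mult_nonpos_nonneg)
        also have "0 \<le> k * y\<^sup>2" using k by simp
        finally show ?thesis .
      next
        case False
        have "k + y \<le> k * (1 + \<bar>y\<bar>)"
          using k mult_right_mono[of 1 k "\<bar>y\<bar>"] by (simp add: algebra_simps)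
        then have "(\<bar>y\<bar> - 1) * (k + y) \<le> (\<bar>y\<bar> - 1) * (k * (1 + \<bar>y\<bar>))"
          using False by (intro mult_left_mono) auto
        also have "\<dots> = k * (y\<^sup>2 - 1)" by (simp add: power2_eq_square algebra_simps flip: abs_mult)
        also have "\<dots> \<le> k * y\<^sup>2" using k by simp
        finally show ?thesis .
      qed
    qed
    then have "\<bar>y\<bar> - 1 \<le> k * y\<^sup>2 / (k + y)" using y by (simp add: field_simps)
    then have "a * (\<bar>y\<bar> - 1) \<le> a * (k * y\<^sup>2 / (k + y))" using a by (intro mult_left_mono) auto
    moreover have "a / 6 * \<bar>y\<bar> \<le> a * \<bar>y\<bar>" using a by (intro mult_right_mono) auto
    moreover have "Re (saddle_exponent \<zeta> k y) = - (a * (k * y\<^sup>2 / (k + y))) - Re (of_real (k ^ 4) * (Ln (1 + w) - w))"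
      using k y by (subst saddle_exponent_eq) (auto simp: w_def a_def)
    ultimately show ?thesis
      using L a zero_le_power2[of a] unfolding a_def[symmetric] right_diff_distrib by linarith
  next
    case False
    define m where "m = k * (k + y) + a"
    have m: "m > a" "m > 0" using ky a by (auto simp: m_def)
    have "k * (k + y) \<le> k * (k / 2)" using False k by (intro mult_left_mono) auto
    then have m34: "m \<le> 3 / 4 * k\<^sup>2"
      using k an unfolding m_def power2_eq_square by linarith
    have rw: "Re w = a / (k * (k + y))" unfolding w_def a_def by (simp add: Re_divide_of_real del: of_real_mult of_real_add)
    then have rwp: "Re w > 0" using a ky by simp
    have "ln (1 + Re w) \<ge> Re w / (1 + Re w)"
    proof -
      have "ln (1 / (1 + Re w)) \<le> 1 / (1 + Re w) - 1"
        using rwp by (intro ln_le_minus_one) simp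
      then show ?thesis using rwp by (simp add: ln_div field_simps)
    qed
    also have "Re w / (1 + Re w) = a / m"
    proof -
      have "a / Q / (1 + a / Q) = a / (Q + a)" if "Q > 0" for Q :: real
        using that a by (simp add: field_simps)
      then show ?thesis unfolding rw m_def using ky by blast
    qed
    finally have "a / m \<le> Re (Ln (1 + w))"
      using Re_Ln_1_plus_ge[OF rwp] by linarith
    then have L: "k ^ 4 * (a / m) \<le> k ^ 4 * Re (Ln (1 + w))" by (intro mult_left_mono) auto
    \<comment> \<open>The bound \<open>m \<le> 3/4 k\<^sup>2\<close> keeps \<open>m\<close> away from \<open>k\<^sup>2\<close>, where the square vanishes.\<close>
    have "m + k ^ 4 / m - 2 * k\<^sup>2 = (k\<^sup>2 - m)\<^sup>2 / m"
      using m by (simp add: field_simps power2_eq_square power4_eq_xxxx)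
    also have "\<dots> \<ge> (k\<^sup>2 / 4)\<^sup>2 / (3 / 4 * k\<^sup>2)"
      using m m34 by (intro frac_le power_mono) auto
    also have "(k\<^sup>2 / 4)\<^sup>2 / (3 / 4 * k\<^sup>2) = k\<^sup>2 / 12"
      using k by (simp add: field_simps power2_eq_square)
    finally have q: "m + k ^ 4 / m - 2 * k\<^sup>2 \<ge> k\<^sup>2 / 12" .
    have "\<bar>y\<bar> \<le> k" using False y k by (simp add: abs_if)
    then have "y\<^sup>2 \<le> k\<^sup>2" using k by (simp add: abs_le_square_iff[symmetric])
    moreover have "2 * \<bar>y\<bar> - 1 \<le> y\<^sup>2"
      using zero_le_power2[of "\<bar>y\<bar> - 1"] by (simp add: power2_eq_square algebra_simps flip: abs_mult)
    ultimately have "m + k ^ 4 / m - 2 * k\<^sup>2 \<ge> \<bar>y\<bar> / 6 - 1" using q by linarith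
    then have "a * (\<bar>y\<bar> / 6 - 1) \<le> a * (m + k ^ 4 / m - 2 * k\<^sup>2)" using a by (intro mult_left_mono) auto
    also have "\<dots> = - (2 * a * k\<^sup>2 - a * (k * (k + y)) - k ^ 4 * (a / m)) + a\<^sup>2"
      unfolding m_def by (simp add: algebra_simps power2_eq_square)
    also have "\<dots> \<le> - Re (saddle_exponent \<zeta> k y) + a\<^sup>2"
    proof -
      have "Re (saddle_exponent \<zeta> k y) = 2 * a * k\<^sup>2 - a * (k * (k + y)) - k ^ 4 * Re (Ln (1 + w))"
        unfolding saddle_exponent_def w_def[symmetric] a_def
        by (simp flip: of_real_power of_real_mult of_real_add)
      then show ?thesis using L by linarith
    qed
    finally have "a * (\<bar>y\<bar> / 6) - a \<le> - Re (saddle_exponent \<zeta> k y) + a\<^sup>2"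
      by (simp add: right_diff_distrib)
    then show ?thesis
      unfolding a_def[symmetric] using zero_le_power2[of "norm \<zeta>"] by linarith
  qed
qed

lemma integrable_exp_abs_decay:
  assumes "d > 0"
  shows "integrable lborel (\<lambda>y::real. C * exp (- d * \<bar>y\<bar>))"
proof -
  have "set_integrable lborel {0..} (\<lambda>y::real. exp (- d * \<bar>y\<bar>))"
  proof (rule set_integrable_discrete_difference[of "{0}" "{0<..}", THEN iffD1])
    show "set_integrable lborel {0<..} (\<lambda>y::real. exp (- d * \<bar>y\<bar>))"
      by (rule set_integrable_cong[OF refl refl, THEN iffD1, OF _ set_integrable_exp_decay[OF assms]]) auto
  qed auto
  then have "has_bochner_integral lborel (\<lambda>y. indicator {0..} y *\<^sub>R exp (- d * \<bar>y\<bar>))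
      (\<integral>y. indicator {0..} y *\<^sub>R exp (- d * \<bar>y\<bar>) \<partial>lborel)"
    unfolding set_integrable_def by (rule has_bochner_integral_integrable)
  from has_bochner_integral_even_function[OF this] show ?thesis
    by (auto simp: has_bochner_integral_iff)
qed

lemma tricomi_Phi_rescaled:
  assumes k: "k > 0" and z: "Re z > 0"
  defines "\<zeta> \<equiv> csqrt z"
  shows "tricomi_Phi (k ^ 4) z * exp (2 * \<zeta> * of_real (k\<^sup>2)) / of_real k =
    1 / \<zeta> * (\<integral>y. indicator {-k<..} y *\<^sub>R exp (saddle_exponent \<zeta> k y) \<partial>lborel)"
proof -
  define E where "E = exp (2 * \<zeta> * of_real (k\<^sup>2))"
  define h where "h = (\<lambda>r. exp (- (\<zeta> * of_real r) - of_real (k ^ 4) * Ln (1 + \<zeta> / of_real r)))"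
  have "tricomi_Phi (k ^ 4) z = 1 / \<zeta> * (LBINT r:{0<..}. h r)"
    unfolding h_def \<zeta>_def by (rule tricomi_Phi_rotated) (use z in auto)
  also have "(LBINT r:{0<..}. h r) = \<bar>k\<bar> *\<^sub>R (\<integral>y. indicator {0<..} (k * k + k * y) *\<^sub>R h (k * k + k * y) \<partial>lborel)"
    unfolding set_lebesgue_integral_def by (rule lborel_integral_real_affine) (use k in simp)
  also have "(\<lambda>y. indicator {0<..} (k * k + k * y) *\<^sub>R h (k * k + k * y)) =
      (\<lambda>y. indicator {-k<..} y *\<^sub>R h (k * (k + y)))"
  proof
    fix y
    have "k * k + k * y > 0 \<longleftrightarrow> y > -k"
      using k zero_less_mult_iff[of k "k + y"] by (auto simp: algebra_simps)
    then show "indicator {0<..} (k * k + k * y) *\<^sub>R h (k * k + k * y) = indicator {-k<..} y *\<^sub>R h (k * (k + y))"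
      by (auto simp: indicator_def algebra_simps)
  qed
  finally have "tricomi_Phi (k ^ 4) z * E / of_real k =
      1 / \<zeta> * ((\<integral>y. indicator {-k<..} y *\<^sub>R h (k * (k + y)) \<partial>lborel) * E)"
    using k by (simp add: scaleR_conv_of_real field_simps)
  also have "(\<integral>y. indicator {-k<..} y *\<^sub>R h (k * (k + y)) \<partial>lborel) * E =
      (\<integral>y. indicator {-k<..} y *\<^sub>R h (k * (k + y)) * E \<partial>lborel)"
    by (rule integral_mult_left_zero[symmetric])
  also have "(\<lambda>y. indicator {-k<..} y *\<^sub>R h (k * (k + y)) * E) =
      (\<lambda>y. indicator {-k<..} y *\<^sub>R exp (saddle_exponent \<zeta> k y))"
    by (rule ext) (simp add: h_def E_def saddle_exponent_def exp_add[symmetric] algebra_simps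
        del: of_real_mult of_real_add of_real_power)
  finally show ?thesis by (simp add: E_def)
qed

text \<open>Dominated convergence: in the rescaled variable the integrand tends to a Gaussian with complex
  parameter \<open>\<zeta>\<close>, whose integral does not vanish.\<close>

lemma tricomi_Phi_tendsto_quartic:
  assumes z: "Re z > 0"
  defines "\<zeta> \<equiv> csqrt z"
  shows "((\<lambda>k. tricomi_Phi (k ^ 4) z * exp (2 * \<zeta> * of_real (k\<^sup>2)) / of_real k) \<longlongrightarrow>
    1 / \<zeta> * (of_real (sqrt pi) / csqrt \<zeta> * exp (\<zeta>\<^sup>2 / 2))) at_top"
proof -
  have \<zeta>: "Re \<zeta> > 0" "\<zeta> \<noteq> 0" using Re_csqrt_pos[OF z] by (auto simp: \<zeta>_def)
  define C where "C = 8 * (norm \<zeta>)\<^sup>2 + (Re \<zeta>)\<^sup>2 + Re \<zeta>"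
  define s where "s = (\<lambda>k y. indicator {-k<..} y *\<^sub>R exp (saddle_exponent \<zeta> k y))"
  define f where "f = (\<lambda>y::real. exp (- (\<zeta> * of_real (y\<^sup>2))) * exp (\<zeta>\<^sup>2 / 2))"
  have "((\<lambda>k. integral\<^sup>L lborel (s k)) \<longlongrightarrow> integral\<^sup>L lborel f) at_top"
  proof (rule integral_dominated_convergence_at_top)
    show "f \<in> borel_measurable lborel"
      unfolding f_def by measurable
    show "s k \<in> borel_measurable lborel" for k
      unfolding s_def saddle_exponent_def by measurable
    show "integrable lborel (\<lambda>y. exp C * exp (- (Re \<zeta> / 6) * \<bar>y\<bar>))"
      using \<zeta> by (intro integrable_exp_abs_decay) simp
    show "AE y in lborel. ((\<lambda>k. s k y) \<longlongrightarrow> f y) at_top"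
    proof (rule AE_I2)
      fix y :: real
      have "((\<lambda>k. exp (saddle_exponent \<zeta> k y)) \<longlongrightarrow> exp (- (\<zeta> * of_real (y\<^sup>2)) + \<zeta>\<^sup>2 / 2)) at_top"
        by (intro tendsto_exp saddle_exponent_tendsto \<zeta>)
      moreover have "eventually (\<lambda>k. exp (saddle_exponent \<zeta> k y) = s k y) at_top"
        using eventually_gt_at_top[of "- y"] by eventually_elim (auto simp: s_def)
      ultimately show "((\<lambda>k. s k y) \<longlongrightarrow> f y) at_top"
        unfolding f_def exp_add[symmetric] by (rule Lim_transform_eventually)
    qed
    show "\<forall>\<^sub>F k in at_top. AE y in lborel. norm (s k y) \<le> exp C * exp (- (Re \<zeta> / 6) * \<bar>y\<bar>)"
      using eventually_ge_at_top[of "max 1 (4 * norm \<zeta>)"]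
    proof eventually_elim
      case (elim k)
      then have k: "k \<ge> 1" "4 * norm \<zeta> \<le> k" by auto
      have "k * 1 \<le> k * k" using k by (intro mult_left_mono) auto
      then have k2: "k\<^sup>2 \<ge> 4 * norm \<zeta>" using k unfolding power2_eq_square by linarith
      show ?case
      proof (rule AE_I2)
        fix y :: real
        show "norm (s k y) \<le> exp C * exp (- (Re \<zeta> / 6) * \<bar>y\<bar>)"
        proof (cases "y > -k")
          case True
          then show ?thesis
            using saddle_exponent_bound[OF \<zeta>(1) k(1) k2, of y]
            by (simp add: s_def C_def exp_add[symmetric])
        qed (simp add: s_def)
      qed
    qed
  qed
  moreover have "integral\<^sup>L lborel f = of_real (sqrt pi) / csqrt \<zeta> * exp (\<zeta>\<^sup>2 / 2)"
    unfolding f_def using complex_gaussian_integral[OF \<zeta>(1)]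
    by (simp add: has_bochner_integral_iff)
  ultimately have "((\<lambda>k. 1 / \<zeta> * integral\<^sup>L lborel (s k)) \<longlongrightarrow>
      1 / \<zeta> * (of_real (sqrt pi) / csqrt \<zeta> * exp (\<zeta>\<^sup>2 / 2))) at_top"
    by (intro tendsto_intros) simp
  moreover have "eventually (\<lambda>k. 1 / \<zeta> * integral\<^sup>L lborel (s k) =
      tricomi_Phi (k ^ 4) z * exp (2 * \<zeta> * of_real (k\<^sup>2)) / of_real k) at_top"
    using eventually_gt_at_top[of 0]
    by eventually_elim (use tricomi_Phi_rescaled[OF _ z] in \<open>simp add: s_def \<zeta>_def\<close>)
  ultimately show ?thesis by (rule Lim_transform_eventually)
qed

text \<open>So \<open>\<bar>tricomi_Phi x z\<bar>\<close> is asymptotically a nonzero multiple of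
  \<open>x^(1/4) exp (- 2 Re (csqrt z) sqrt x)\<close>, also for complex \<open>z\<close>.\<close>

theorem tricomi_Phi_asymp:
  assumes z: "Re z > 0"
  obtains C where "C \<noteq> 0"
    "((\<lambda>x. tricomi_Phi x z * exp (2 * csqrt z * of_real (sqrt x)) / of_real (x powr (1/4))) \<longlongrightarrow> C) at_top"
proof -
  define \<zeta> where "\<zeta> = csqrt z"
  define C where "C = 1 / \<zeta> * (of_real (sqrt pi) / csqrt \<zeta> * exp (\<zeta>\<^sup>2 / 2))"
  have "Re \<zeta> > 0" "\<zeta> \<noteq> 0" using Re_csqrt_pos[OF z] by (auto simp: \<zeta>_def)
  then have "C \<noteq> 0" by (simp add: C_def)
  have "filterlim (\<lambda>x::real. x powr (1/4)) at_top at_top" by real_asymp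
  from filterlim_compose[OF tricomi_Phi_tendsto_quartic[OF z] this]
  have "((\<lambda>x. tricomi_Phi ((x powr (1/4)) ^ 4) z * exp (2 * \<zeta> * of_real ((x powr (1/4))\<^sup>2)) / of_real (x powr (1/4))) \<longlongrightarrow> C) at_top"
    unfolding C_def \<zeta>_def .
  moreover have "eventually (\<lambda>x. tricomi_Phi ((x powr (1/4)) ^ 4) z * exp (2 * \<zeta> * of_real ((x powr (1/4))\<^sup>2)) / of_real (x powr (1/4))
     = tricomi_Phi x z * exp (2 * \<zeta> * of_real (sqrt x)) / of_real (x powr (1/4))) at_top"
    using eventually_gt_at_top[of 0]
  proof eventually_elim
    case (elim x)
    have "(x powr (1/4)) ^ 4 = x" "(x powr (1/4))\<^sup>2 = sqrt x"
      using elim by (simp_all add: powr_power powr_half_sqrt)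
    then show ?case by (simp only:)
  qed
  ultimately have "((\<lambda>x. tricomi_Phi x z * exp (2 * \<zeta> * of_real (sqrt x)) / of_real (x powr (1/4))) \<longlongrightarrow> C) at_top"
    by (rule Lim_transform_eventually)
  with \<open>C \<noteq> 0\<close> show ?thesis by (intro that[of C]) (auto simp: \<zeta>_def)
qed

lemma tricomi_Phi_bigtheta:
  assumes z: "Re z > 0"
  shows "(\<lambda>x. tricomi_Phi x z) \<in>
    \<Theta>[at_top](\<lambda>x. of_real (x powr (1/4) * exp (- 2 * Re (csqrt z) * sqrt x)))"
proof -
  obtain C where C: "C \<noteq> 0"
    "((\<lambda>x. tricomi_Phi x z * exp (2 * csqrt z * of_real (sqrt x)) / of_real (x powr (1/4))) \<longlongrightarrow> C) at_top"
    using tricomi_Phi_asymp[OF z] .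
  define E where "E = (\<lambda>x. complex_of_real (x powr (1/4)) / exp (2 * csqrt z * of_real (sqrt x)))"
  have "((\<lambda>x. tricomi_Phi x z / E x) \<longlongrightarrow> C) at_top"
    using C(2) by (simp add: E_def)
  then have "(\<lambda>x. tricomi_Phi x z) \<in> \<Theta>[at_top](E)"
    using C(1) by (intro bigthetaI_tendsto_norm[where c = "norm C"] tendsto_norm) simp_all
  then have "(\<lambda>x. norm (tricomi_Phi x z)) \<in> \<Theta>[at_top](\<lambda>x. norm (E x))"
    by simp
  moreover have "norm (E x) = norm (complex_of_real (x powr (1/4) * exp (- 2 * Re (csqrt z) * sqrt x)))" for x
  proof -
    define k where "k = Re (csqrt z)"
    have "Re (2 * csqrt z * of_real (sqrt x)) = 2 * k * sqrt x"
      by (simp add: k_def del: csqrt.sel)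
    then have "norm (E x) = x powr (1/4) / exp (2 * k * sqrt x)"
      by (simp only: E_def norm_divide norm_exp_eq_Re norm_of_real abs_of_nonneg powr_ge_zero)
    also have "\<dots> = x powr (1/4) * exp (- 2 * k * sqrt x)"
    proof -
      have "- 2 * k * sqrt x = - (2 * k * sqrt x)" by simp
      then show ?thesis by (simp only: exp_minus divide_inverse)
    qed
    also have "\<dots> = norm (complex_of_real (x powr (1/4) * exp (- 2 * k * sqrt x)))"
      by (simp only: norm_of_real abs_mult abs_exp_cancel abs_of_nonneg powr_ge_zero)
    finally show ?thesis by (simp only: k_def)
  qed
  ultimately show ?thesis by (simp only: landau_theta.norm_iff)
qed

lemma exp_sqrt_smallo_tricomi_Phi:
  assumes z: "Re z > 0" and k: "k > Re (csqrt z)"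
  shows "(\<lambda>x. of_real (exp (- 2 * k * sqrt x))) \<in> o[at_top](\<lambda>x. tricomi_Phi x z)"
proof -
  define e where "e = k - Re (csqrt z)"
  have e: "e > 0" using k by (simp add: e_def)
  have "((\<lambda>x. x powr (- 1/4) * exp (- 2 * e * sqrt x)) \<longlongrightarrow> 0) at_top"
    using e by real_asymp
  then have "((\<lambda>x. complex_of_real (x powr (- 1/4) * exp (- 2 * e * sqrt x))) \<longlongrightarrow> of_real 0) at_top"
    by (rule tendsto_of_real)
  moreover have "eventually (\<lambda>x. complex_of_real (x powr (- 1/4) * exp (- 2 * e * sqrt x)) =
      of_real (exp (- 2 * k * sqrt x)) / of_real (x powr (1/4) * exp (- 2 * Re (csqrt z) * sqrt x))) at_top"
    using eventually_gt_at_top[of 0]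
  proof eventually_elim
    case (elim x)
    have "exp (- 2 * k * sqrt x) = exp (- 2 * e * sqrt x) * exp (- 2 * Re (csqrt z) * sqrt x)"
      by (simp add: e_def exp_add[symmetric] algebra_simps)
    then have "x powr (- 1/4) * exp (- 2 * e * sqrt x) = exp (- 2 * k * sqrt x) / (x powr (1/4) * exp (- 2 * Re (csqrt z) * sqrt x))"
      using elim by (simp add: powr_minus field_simps)
    then show ?case by (simp only: of_real_divide)
  qed
  ultimately have "((\<lambda>x. of_real (exp (- 2 * k * sqrt x)) / complex_of_real (x powr (1/4) * exp (- 2 * Re (csqrt z) * sqrt x))) \<longlongrightarrow> 0) at_top"
    by (simp add: tendsto_cong)
  moreover have "eventually (\<lambda>x. complex_of_real (x powr (1/4) * exp (- 2 * Re (csqrt z) * sqrt x)) \<noteq> 0) at_top"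
    using eventually_gt_at_top[of 0] by eventually_elim simp
  ultimately have "(\<lambda>x. of_real (exp (- 2 * k * sqrt x))) \<in> o[at_top](\<lambda>x. complex_of_real (x powr (1/4) * exp (- 2 * Re (csqrt z) * sqrt x)))"
    by (rule smalloI_tendsto)
  then show ?thesis
    using landau_o.small.cong_bigtheta[OF tricomi_Phi_bigtheta[OF z]] by simp
qed

text \<open>The order in which the functions \<open>\<Phi>\<close> decrease is that of \<open>Re (csqrt z)\<close>, not of \<open>Re z\<close>.\<close>

lemma tricomi_Phi_smallo_tricomi_Phi:
  assumes z: "Re z > 0" and w: "Re (csqrt z) < Re (csqrt w)" "Re w > 0"
  shows "(\<lambda>x. tricomi_Phi x w) \<in> o[at_top](\<lambda>x. tricomi_Phi x z)"
proof -
  \<comment> \<open>A rate strictly between the two exponents absorbs the power of \<open>x\<close>.\<close>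
  define k where "k = (Re (csqrt z) + Re (csqrt w)) / 2"
  define e where "e = Re (csqrt w) - k"
  have k: "Re (csqrt z) < k" "e > 0" using w by (auto simp: k_def e_def)
  have "(\<lambda>x. x powr (1/4) * exp (- 2 * (k + e) * sqrt x)) \<in> O[at_top](\<lambda>x. exp (- 2 * k * sqrt x))"
  proof -
    have "((\<lambda>x. x powr (1/4) * exp (- 2 * e * sqrt x)) \<longlongrightarrow> 0) at_top"
      using k(2) by real_asymp
    moreover have "exp (- 2 * e * sqrt x) = exp (- 2 * (k + e) * sqrt x) / exp (- 2 * k * sqrt x)" for x
      unfolding exp_diff[symmetric] by (simp add: algebra_simps)
    ultimately have "((\<lambda>x. x powr (1/4) * exp (- 2 * (k + e) * sqrt x) / exp (- 2 * k * sqrt x)) \<longlongrightarrow> 0) at_top"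
      by (simp only: times_divide_eq_right)
    then have "(\<lambda>x. x powr (1/4) * exp (- 2 * (k + e) * sqrt x)) \<in> o[at_top](\<lambda>x. exp (- 2 * k * sqrt x))"
      by (rule smalloI_tendsto) simp
    then show ?thesis by (rule landau_o.small_imp_big)
  qed
  then have "(\<lambda>x. complex_of_real (x powr (1/4) * exp (- 2 * Re (csqrt w) * sqrt x))) \<in> O[at_top](\<lambda>x. of_real (exp (- 2 * k * sqrt x)))"
    by (simp only: landau_o.big.of_real_iff e_def add_diff_cancel_left' diff_add_cancel add.commute[of k])
  then have "(\<lambda>x. tricomi_Phi x w) \<in> O[at_top](\<lambda>x. of_real (exp (- 2 * k * sqrt x)))"
    using tricomi_Phi_bigtheta[OF w(2)] by (meson landau_o.big_trans bigthetaD1)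
  then show ?thesis
    using exp_sqrt_smallo_tricomi_Phi[OF z k(1)] by (rule landau_o.big_small_trans)
qed

lemma exp_linear_smallo_tricomi_Phi:
  assumes z: "Re z > 0" and c: "c > 0"
  shows "(\<lambda>x. of_real (exp (- x * c))) \<in> o[at_top](\<lambda>x. tricomi_Phi x z)"
proof -
  define k where "k = Re (csqrt z) + 1"
  have k: "k > 0" using Re_csqrt_pos[OF z] unfolding k_def by linarith
  have "(\<lambda>x. exp (- x * c)) \<in> O[at_top](\<lambda>x. exp (- 2 * k * sqrt x))"
    using c k by real_asymp
  then have "(\<lambda>x. complex_of_real (exp (- x * c))) \<in> O[at_top](\<lambda>x. of_real (exp (- 2 * k * sqrt x)))"
    by (simp only: landau_o.big.of_real_iff)
  moreover have "(\<lambda>x. of_real (exp (- 2 * k * sqrt x))) \<in> o[at_top](\<lambda>x. tricomi_Phi x z)"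
    by (rule exp_sqrt_smallo_tricomi_Phi[OF z]) (simp add: k_def)
  ultimately show ?thesis by (rule landau_o.big_small_trans)
qed

lemma Re_csqrt_add_pos_less:
  assumes "r > 0" "Re z > 0"
  shows "Re (csqrt z) < Re (csqrt (z + of_real r))"
proof -
  have "norm z \<le> norm (z + of_real r)"
    using assms by (auto simp: cmod_def intro!: power_mono)
  then have "(norm z + Re z) / 2 < (norm (z + of_real r) + Re (z + of_real r)) / 2"
    using assms by simp
  then show ?thesis by simp
qed

section \<open>Lagrange inversion at the starting point\<close>

text \<open>With \<open>G = R^(- k)\<close> the product is \<open>G - X G' / k\<close>, and the coefficient of index \<open>k\<close> of \<open>X G'\<close>
  is \<open>k\<close> times that of \<open>G\<close>.  In terms of residues: \<open>V^(- k - 1) V'\<close> with \<open>V = X R\<close> is a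
  derivative, so it has no residue.\<close>

lemma fps_nth_power_deriv_identity:
  fixes R :: "'a::field_char_0 fps"
  assumes "R $ 0 \<noteq> 0" "k \<ge> 1"
  shows "(fps_deriv (fps_X * R) * inverse R ^ Suc k) $ k = 0"
proof -
  define G where "G = inverse R ^ k"
  have RR: "R * inverse R = 1"
    using assms(1) by (simp add: inverse_mult_eq_1')
  have dG: "fps_deriv G = - (of_nat k * (fps_deriv R * inverse R ^ Suc k))"
  proof -
    have "fps_deriv (inverse R) = - (fps_deriv R * inverse R ^ 2)"
      using assms(1) by (simp add: fps_inverse_deriv)
    then have "fps_deriv G = - (of_nat k * (fps_deriv R * (inverse R ^ (k - 1) * inverse R ^ 2)))"
      unfolding G_def by (simp add: fps_deriv_power mult_ac fps_of_nat)
    also have "inverse R ^ (k - 1) * inverse R ^ 2 = inverse R ^ Suc k"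
      using assms(2) by (simp flip: power_add)
    finally show ?thesis .
  qed
  have "fps_deriv (fps_X * R) * inverse R ^ Suc k
      = (R * inverse R) * inverse R ^ k + fps_X * (fps_deriv R * inverse R ^ Suc k)"
    by (simp add: algebra_simps)
  also have "(of_nat k * \<dots>) = of_nat k * G - fps_X * fps_deriv G"
    unfolding dG RR by (simp add: G_def algebra_simps)
  finally have "(of_nat k * (fps_deriv (fps_X * R) * inverse R ^ Suc k)) $ k
      = (of_nat k * G - fps_X * fps_deriv G) $ k"
    by simp
  also have "\<dots> = 0" using assms(2) by (cases k) (auto simp: fps_of_nat[symmetric])
  finally show ?thesis using assms(2) by (simp add: fps_of_nat[symmetric])
qed

text \<open>Lagrange inversion: with \<open>V = X R\<close>, the numbers \<open>g m\<close> are the coefficients of \<open>F\<close> with respect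
  to the system \<open>V^m V'\<close>.  By induction on \<open>M\<close>, the partial remainder \<open>D\<close> starts in degree \<open>M\<close>.
  The coefficient of index \<open>M\<close> of \<open>F R^(- M - 1)\<close> sees only \<open>D\<close>, as the earlier terms drop out by
  the previous lemma, and so it is the multiple of \<open>V^M V'\<close> needed to cancel the leading
  coefficient of \<open>D\<close>.\<close>

lemma fps_lagrange_expansion:
  fixes F R :: "'a::field_char_0 fps"
  assumes R: "R $ 0 \<noteq> 0"
  defines "g \<equiv> \<lambda>m. (F * inverse R ^ Suc m) $ m"
  assumes "n < M"
  shows "(F - (\<Sum>m<M. fps_const (g m) * ((fps_X * R) ^ m * fps_deriv (fps_X * R)))) $ n = 0"
  using \<open>n < M\<close>
proof (induction M arbitrary: n)
  case (Suc M)
  define V' where "V' = fps_deriv (fps_X * R)"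
  define D where "D = F - (\<Sum>m<M. fps_const (g m) * ((fps_X * R) ^ m * V'))"
  have RR: "R * inverse R = 1"
    using R by (simp add: inverse_mult_eq_1')
  have low: "D $ i = 0" if "i < M" for i
    using Suc.IH[OF that] by (simp add: D_def V'_def)
  have V'0: "V' $ 0 = R $ 0" by (simp add: V'_def)
  have step: "(F - (\<Sum>m<Suc M. fps_const (g m) * ((fps_X * R) ^ m * V'))) $ n
      = D $ n - g M * (fps_X ^ M * (R ^ M * V')) $ n"
    by (simp add: D_def power_mult_distrib mult.assoc fps_mult_left_const_nth diff_diff_eq)
  show ?case
  proof (cases "n < M")
    case True
    then show ?thesis
      using step low by (simp add: V'_def fps_X_power_mult_nth)
  next
    case False
    then have n: "n = M" using Suc.prems by simp
    have "g M = (D * inverse R ^ Suc M) $ M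
        + (\<Sum>m<M. g m * (((fps_X * R) ^ m * V') * inverse R ^ Suc M) $ M)"
    proof -
      have "F = D + (\<Sum>m<M. fps_const (g m) * ((fps_X * R) ^ m * V'))" by (simp add: D_def)
      then have "g M = ((D + (\<Sum>m<M. fps_const (g m) * ((fps_X * R) ^ m * V'))) * inverse R ^ Suc M) $ M"
        by (simp add: g_def)
      then show ?thesis
        by (simp add: distrib_right sum_distrib_right fps_sum_nth mult.assoc fps_mult_left_const_nth del: power_Suc)
    qed
    also have "(\<Sum>m<M. g m * (((fps_X * R) ^ m * V') * inverse R ^ Suc M) $ M) = 0"
    proof (rule sum.neutral, rule ballI)
      fix m assume "m \<in> {..<M}"
      then have m: "m < M" by simp
      have "((fps_X * R) ^ m * V') * inverse R ^ Suc M
          = fps_X ^ m * (V' * ((R * inverse R) ^ m * inverse R ^ Suc (M - m)))"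
      proof -
        have "inverse R ^ Suc M = inverse R ^ m * inverse R ^ Suc (M - m)"
          using m by (simp flip: power_add power_Suc)
        then show ?thesis by (simp only: power_mult_distrib mult_ac)
      qed
      then have "(((fps_X * R) ^ m * V') * inverse R ^ Suc M) $ M
          = (fps_X ^ m * (V' * inverse R ^ Suc (M - m))) $ M"
        by (simp only: RR power_one mult_1_left)
      also have "\<dots> = (V' * inverse R ^ Suc (M - m)) $ (M - m)"
        using m by (simp add: fps_X_power_mult_nth del: power_Suc)
      also have "\<dots> = 0"
        unfolding V'_def using m by (intro fps_nth_power_deriv_identity R) auto
      finally show "g m * (((fps_X * R) ^ m * V') * inverse R ^ Suc M) $ M = 0"
        by simp
    qed
    also have "(D * inverse R ^ Suc M) $ M = D $ M * inverse (R $ 0) ^ Suc M"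
    proof -
      have "(D * inverse R ^ Suc M) $ M = (\<Sum>i\<in>{0..M}. D $ i * (inverse R ^ Suc M) $ (M - i))"
        by (rule fps_mult_nth)
      also have "\<dots> = (\<Sum>i\<in>{M}. D $ i * (inverse R ^ Suc M) $ (M - i))"
        by (rule sum.mono_neutral_right) (auto simp: low simp del: power_Suc)
      finally show ?thesis by (simp add: fps_power_zeroth del: power_Suc)
    qed
    finally have gM: "g M = D $ M * inverse (R $ 0) ^ Suc M" by simp
    have "g M * (fps_X ^ M * (R ^ M * V')) $ n = D $ M"
    proof -
      have "(fps_X ^ M * (R ^ M * V')) $ n = (R $ 0) ^ Suc M"
        by (simp add: n fps_X_power_mult_nth V'0 fps_power_zeroth)
      then show ?thesis
        using R by (simp add: gM mult.assoc power_inverse del: power_Suc)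
    qed
    then show ?thesis using step n by (simp add: V'_def)
  qed
qed simp

lemma has_fps_expansion_imp_power_bound:
  fixes f :: "complex \<Rightarrow> complex"
  assumes f: "f has_fps_expansion F" and F: "\<And>n. n < M \<Longrightarrow> F $ n = 0"
  obtains C where "eventually (\<lambda>x. norm (f x) \<le> C * norm x ^ M) (nhds 0)"
proof (cases "F = 0")
  case True
  then have "eventually (\<lambda>x. f x = 0) (nhds 0)"
    using f by (auto simp: has_fps_expansion_def elim!: eventually_mono)
  then have "eventually (\<lambda>x. norm (f x) \<le> 0 * norm x ^ M) (nhds 0)"
    by eventually_elim simp
  then show ?thesis by (rule that)
next
  case False
  then have M: "M \<le> subdegree F" by (metis F leI nth_subdegree_nonzero)
  define g where "g = (\<lambda>x. if x = 0 then F $ M else f x / x ^ M)"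
  have "g has_fps_expansion fps_shift M F"
    unfolding g_def by (rule has_fps_expansion_shift[OF f M refl])
  then have "isCont g 0" by (rule has_fps_expansion_imp_continuous)
  then have "eventually (\<lambda>x. dist (g x) (g 0) < 1) (nhds 0)"
    unfolding isCont_def tendsto_at_iff_tendsto_nhds by (rule tendstoD) simp
  then have "eventually (\<lambda>x. norm (f x) \<le> (norm (g 0) + 1) * norm x ^ M) (nhds 0)"
  proof eventually_elim
    case (elim x)
    have "f x = g x * x ^ M"
    proof (cases "x = 0")
      case True
      have "f 0 = F $ 0" using f by (metis has_fps_expansion_imp_0_eq_fps_nth_0)
      then show ?thesis using True F by (cases "M = 0") (auto simp: g_def)
    qed (simp add: g_def)
    moreover have "norm (g x) \<le> norm (g 0) + 1"
      using elim by (metis dist_norm less_imp_le norm_triangle_sub add_left_mono order_trans)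
    ultimately show ?case by (simp add: norm_mult norm_power mult_right_mono)
  qed
  then show ?thesis by (rule that)
qed

lemma branch_powr_add:
  assumes "p w \<noteq> 0"
  shows "branch_powr t0 T \<beta>0 p (x + y) w = branch_powr t0 T \<beta>0 p x w * branch_powr t0 T \<beta>0 p y w"
proof -
  have "exp (- (\<i> * (x + y) * of_real (\<beta>0 * segment_arg t0 T)))
     = exp (- (\<i> * x * of_real (\<beta>0 * segment_arg t0 T))) * exp (- (\<i> * y * of_real (\<beta>0 * segment_arg t0 T)))"
    by (simp add: exp_add[symmetric] algebra_simps)
  then show ?thesis
    by (simp add: branch_powr_def powr_add)
qed

lemma branch_powr_nonzero: "p w \<noteq> 0 \<Longrightarrow> branch_powr t0 T \<beta>0 p x w \<noteq> 0"
  by (simp add: branch_powr_def powr_def)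

lemma branch_powr_of_nat_mult:
  assumes "p w \<noteq> 0"
  shows "branch_powr t0 T \<beta>0 p (of_nat n * x) w = branch_powr t0 T \<beta>0 p x w ^ n"
proof (induction n)
  case 0
  show ?case using assms by (simp add: branch_powr_def powr_def)
next
  case (Suc n)
  have "branch_powr t0 T \<beta>0 p (of_nat (Suc n) * x) w = branch_powr t0 T \<beta>0 p (x + of_nat n * x) w"
    by (simp add: algebra_simps)
  then show ?case using Suc assms by (simp add: branch_powr_add)
qed

lemma branch_powr_chi:
  assumes "p w \<noteq> 0"
  shows "branch_powr t0 T \<beta>0 p (chi \<alpha>0 \<beta>0 n) w =
    branch_powr t0 T \<beta>0 p (\<alpha>0 / of_real \<beta>0) w * branch_powr t0 T \<beta>0 p (1 / of_real \<beta>0) w ^ Suc n"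
proof -
  have "chi \<alpha>0 \<beta>0 n = \<alpha>0 / of_real \<beta>0 + of_nat (Suc n) * (1 / of_real \<beta>0)"
    by (simp add: chi_def add_divide_distrib algebra_simps)
  then show ?thesis
    by (simp only: branch_powr_add[where p = p and w = w, OF assms]
        branch_powr_of_nat_mult[where p = p and w = w, OF assms])
qed

text \<open>The Lagrange expansion at \<open>t0\<close> with \<open>R = p^(1 / \<beta>0)\<close> and \<open>F = q p^(- \<alpha>0 / \<beta>0)\<close>.  Here
  \<open>F R^(- m - 1)\<close> equals \<open>q p^(- \<chi>\<^sub>m)\<close>, whose Taylor coefficient of index \<open>m\<close> is \<open>\<beta>0\<close> times
  \<open>coeff_c\<close>.\<close>

lemma lagrange_remainder_bound:
  fixes t0 :: real
  assumes T: "T \<noteq> ereal t0"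
    and F: "factorization_condition t0 T a \<psi> R \<alpha>0 \<beta>0 q p"
  defines "V \<equiv> \<lambda>\<xi>. \<xi> * branch_powr t0 T \<beta>0 p (1 / of_real \<beta>0) (of_real t0 + \<xi>)"
  obtains C where "eventually (\<lambda>\<xi>. norm (
      q (of_real t0 + \<xi>) / branch_powr t0 T \<beta>0 p (\<alpha>0 / of_real \<beta>0) (of_real t0 + \<xi>)
      - (\<Sum>m<M. of_real \<beta>0 * coeff_c t0 T \<alpha>0 \<beta>0 q p m * (V \<xi> ^ m * deriv V \<xi>)))
      \<le> C * norm \<xi> ^ M) (nhds 0)"
proof -
  let ?B = "branch_powr t0 T \<beta>0 p" and ?t = "complex_of_real t0"
  have R: "R > 0" "q analytic_on ball ?t R" "p analytic_on ball ?t R" and p0: "p ?t \<noteq> 0" and b: "\<beta>0 > 0"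
    using F by (auto simp: factorization_condition_def)
  have qa: "q analytic_on {?t}" and pa: "p analytic_on {?t}"
    using R by (auto intro: analytic_on_subset)
  have Ba: "?B \<kappa> analytic_on {?t}" for \<kappa>
    by (rule branch_powr_analytic[OF T F])
  have B0: "?B \<kappa> ?t \<noteq> 0" for \<kappa>
    using p0 by (rule branch_powr_nonzero)
  define Q where "Q = (\<lambda>w. q w / ?B (\<alpha>0 / of_real \<beta>0) w)"
  have Qa: "Q analytic_on {?t}"
    unfolding Q_def using qa Ba B0 by (intro analytic_intros) auto
  define RF where "RF = fps_expansion (?B (1 / of_real \<beta>0)) ?t"
  define QF where "QF = fps_expansion Q ?t"
  have RFe: "(\<lambda>\<xi>. ?B (1 / of_real \<beta>0) (?t + \<xi>)) has_fps_expansion RF"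
    unfolding RF_def by (rule analytic_at_imp_has_fps_expansion[OF Ba])
  have QFe: "(\<lambda>\<xi>. Q (?t + \<xi>)) has_fps_expansion QF"
    unfolding QF_def by (rule analytic_at_imp_has_fps_expansion[OF Qa])
  have RF0: "RF $ 0 \<noteq> 0"
    using B0 by (simp add: RF_def fps_expansion_def)
  have pnz: "eventually (\<lambda>\<xi>. p (?t + \<xi>) \<noteq> 0) (nhds 0)"
  proof -
    have "isCont (\<lambda>\<xi>. p (?t + \<xi>)) 0"
      by (rule has_fps_expansion_imp_continuous[OF analytic_at_imp_has_fps_expansion[OF pa]])
    then have "((\<lambda>\<xi>. p (?t + \<xi>)) \<longlongrightarrow> p ?t) (nhds 0)"
      using tendsto_at_iff_tendsto_nhds[of "\<lambda>\<xi>. p (?t + \<xi>)" 0] by (simp add: isCont_def)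
    then show ?thesis
      using p0 by (rule tendsto_imp_eventually_ne)
  qed
  have coef: "of_real \<beta>0 * coeff_c t0 T \<alpha>0 \<beta>0 q p m = (QF * inverse RF ^ Suc m) $ m" for m
  proof -
    let ?h = "\<lambda>w. q w / ?B (chi \<alpha>0 \<beta>0 m) w"
    have "?h analytic_on {?t}"
      using qa Ba B0 by (intro analytic_intros) auto
    then have E1: "(\<lambda>\<xi>. ?h (?t + \<xi>)) has_fps_expansion fps_expansion ?h ?t"
      by (rule analytic_at_imp_has_fps_expansion)
    have E2: "(\<lambda>\<xi>. Q (?t + \<xi>) * inverse (?B (1 / of_real \<beta>0) (?t + \<xi>)) ^ Suc m) has_fps_expansion QF * inverse RF ^ Suc m"
      by (intro has_fps_expansion_mult has_fps_expansion_power has_fps_expansion_inverse QFe RFe RF0)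
    have ev: "eventually (\<lambda>\<xi>. ?h (?t + \<xi>) = Q (?t + \<xi>) * inverse (?B (1 / of_real \<beta>0) (?t + \<xi>)) ^ Suc m) (nhds 0)"
      using pnz
    proof eventually_elim
      case (elim \<xi>)
      show ?case
        unfolding branch_powr_chi[where p = p and w = "?t + \<xi>", OF elim] Q_def by (simp add: divide_inverse power_inverse del: power_Suc)
    qed
    have "(\<lambda>\<xi>. ?h (?t + \<xi>)) has_fps_expansion QF * inverse RF ^ Suc m"
      unfolding has_fps_expansion_cong[OF ev refl] by (rule E2)
    then have "QF * inverse RF ^ Suc m = fps_expansion ?h ?t"
      by (rule fps_expansion_unique_complex[OF _ E1])
    then have "(QF * inverse RF ^ Suc m) $ m = (deriv ^^ m) ?h ?t / fact m"
      by (simp only: fps_expansion_def fps_nth_Abs_fps)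
    then show ?thesis using b by (simp add: coeff_c_def)
  qed
  have Ve: "V has_fps_expansion fps_X * RF"
    unfolding V_def by (intro has_fps_expansion_mult has_fps_expansion_fps_X RFe)
  have "(\<lambda>\<xi>. Q (?t + \<xi>) - (\<Sum>m<M. of_real \<beta>0 * coeff_c t0 T \<alpha>0 \<beta>0 q p m * (V \<xi> ^ m * deriv V \<xi>)))
     has_fps_expansion
      QF - (\<Sum>m<M. fps_const ((QF * inverse RF ^ Suc m) $ m) * ((fps_X * RF) ^ m * fps_deriv (fps_X * RF)))"
    unfolding coef
    by (intro has_fps_expansion_diff has_fps_expansion_sum has_fps_expansion_cmult_left
        has_fps_expansion_mult has_fps_expansion_power has_fps_expansion_deriv QFe Ve)
  from has_fps_expansion_imp_power_bound[OF this fps_lagrange_expansion[OF RF0]]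
  show ?thesis unfolding Q_def using that by blast
qed

section \<open>The integrand in a local coordinate\<close>

text \<open>The number \<open>exp (\<i> \<omega>)\<close>, so that \<open>t0 + segment_sign t0 T * x\<close> with \<open>x > 0\<close> runs along the
  segment.\<close>

definition segment_sign :: "real \<Rightarrow> ereal \<Rightarrow> real" where
  "segment_sign t0 T = (if ereal t0 < T then 1 else - 1)"

lemma exp_segment_arg: "exp (\<i> * of_real (segment_arg t0 T)) = of_real (segment_sign t0 T)"
  by (simp add: segment_arg_def segment_sign_def)

lemma exp_minus_segment_arg: "exp (- (\<i> * of_real (segment_arg t0 T))) = of_real (segment_sign t0 T)"
  by (simp add: segment_arg_def segment_sign_def exp_minus)

lemma segment_sign_square [simp]: "segment_sign t0 T * segment_sign t0 T = 1"
  and abs_segment_sign [simp]: "\<bar>segment_sign t0 T\<bar> = 1"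
  and segment_sign_nonzero [simp]: "segment_sign t0 T \<noteq> 0"
  by (simp_all add: segment_sign_def)

lemma segment_param_mem:
  assumes t: "t \<in> segment_from t0 T" and x: "0 < x" "x \<le> \<bar>t - t0\<bar>"
  shows "t0 + segment_sign t0 T * x \<in> segment_from t0 T"
proof (cases "ereal t0 < T")
  case True
  then have "t0 < t" "ereal t < T"
    using t by (auto simp: segment_from_def einterval_def min_def max_def split: if_splits)
  moreover then have "ereal (t0 + x) \<le> ereal t" using x by simp
  ultimately have "ereal (t0 + x) < T" by (metis le_less_trans)
  then show ?thesis using True x
    by (auto simp: segment_from_def einterval_def min_def max_def segment_sign_def)
next
  case False
  then have "t < t0" "T < ereal t"
    using t by (auto simp: segment_from_def einterval_def min_def max_def split: if_splits)
  moreover then have "ereal t \<le> ereal (t0 - x)" using x by simp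
  ultimately have "T < ereal (t0 - x)" by (metis less_le_trans)
  then show ?thesis using False x
    by (auto simp: segment_from_def einterval_def min_def max_def segment_sign_def)
qed

lemma segment_param_eq:
  assumes "t \<in> segment_from t0 T"
  shows "t = t0 + segment_sign t0 T * \<bar>t - t0\<bar>" "t \<noteq> t0"
  using assms
  by (auto simp: segment_from_def einterval_def min_def max_def segment_sign_def abs_if split: if_splits)

text \<open>On the segment every power in the factorization reduces to a power of the positive number
  \<open>v = x \<bar>p\<bar>^(1 / \<beta>0)\<close>: the phases of the branch of \<open>p\<close> cancel those of \<open>(t - t0)^\<gamma>\<close>.\<close>

lemma real_branch_values:
  fixes x :: real
  assumes T: "T \<noteq> ereal t0"
    and F: "factorization_condition t0 T a \<psi> R \<alpha>0 \<beta>0 q p"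
    and x: "x > 0" "x < R"
  defines "t \<equiv> t0 + segment_sign t0 T * x"
  assumes t: "t \<in> segment_from t0 T"
  defines "v \<equiv> x * norm (p (of_real t)) powr (1 / \<beta>0)"
  shows "v > 0" "\<psi> t = v powr \<beta>0"
    "of_real (segment_sign t0 T * x) * branch_powr t0 T \<beta>0 p (1 / of_real \<beta>0) (of_real t) = of_real v"
    "a t = of_real v powr \<alpha>0 * (q (of_real t) / branch_powr t0 T \<beta>0 p (\<alpha>0 / of_real \<beta>0) (of_real t))"
proof -
  define \<omega> where "\<omega> = segment_arg t0 T"
  define \<sigma> where "\<sigma> = segment_sign t0 T"
  have b: "\<beta>0 > 0" using F by (simp add: factorization_condition_def)
  have ab: "\<bar>t - t0\<bar> = x" using x by (simp add: t_def abs_mult)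
  have tR: "\<bar>t - t0\<bar> < R" using x ab by simp
  have np: "norm (p (of_real t)) > 0" by (rule segment_factor_pos(1)[OF F t tR])
  then show v: "v > 0" using x by (simp add: v_def)
  have a: "a t = segment_powr t0 T \<alpha>0 t * q (of_real t)"
    and psi: "of_real (\<psi> t) = segment_powr t0 T (of_real \<beta>0) t * p (of_real t)"
    using F t tR by (auto simp: factorization_condition_def)
  have "complex_of_real (\<psi> t) = of_real x powr of_real \<beta>0 * (p (of_real t) * exp (\<i> * of_real (\<beta>0 * segment_arg t0 T)))"
    unfolding psi segment_powr_def ab by (simp add: mult_ac)
  also have "\<dots> = of_real (x powr \<beta>0 * norm (p (of_real t)))"
    unfolding segment_factor_pos(2)[OF F t tR] using x by (simp add: powr_of_real)
  finally have "\<psi> t = x powr \<beta>0 * norm (p (of_real t))" by (simp only: of_real_eq_iff)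
  also have "\<dots> = v powr \<beta>0"
    using x np b by (simp add: v_def powr_mult powr_powr)
  finally show "\<psi> t = v powr \<beta>0" .
  have B: "branch_powr t0 T \<beta>0 p \<kappa> (of_real t) =
    of_real (norm (p (of_real t))) powr \<kappa> * exp (- (\<i> * \<kappa> * of_real (\<beta>0 * \<omega>)))" for \<kappa>
    unfolding \<omega>_def by (rule branch_powr_segment[OF T F]) (use t tR in simp)
  have e1: "exp (- (\<i> * (1 / of_real \<beta>0) * of_real (\<beta>0 * \<omega>))) = of_real \<sigma>"
    using b exp_minus_segment_arg[of t0 T] by (simp add: \<omega>_def \<sigma>_def)
  have "of_real (norm (p (of_real t))) powr (1 / of_real \<beta>0) = complex_of_real (norm (p (of_real t)) powr (1 / \<beta>0))"
    using np by (simp flip: powr_of_real)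
  then show "of_real (segment_sign t0 T * x) * branch_powr t0 T \<beta>0 p (1 / of_real \<beta>0) (of_real t) = of_real v"
    unfolding B e1 \<sigma>_def[symmetric] v_def
    by (simp add: mult_ac flip: of_real_mult) (simp add: \<sigma>_def flip: mult.assoc)
  have e2: "exp (- (\<i> * (\<alpha>0 / of_real \<beta>0) * of_real (\<beta>0 * \<omega>))) = exp (- (\<i> * \<alpha>0 * of_real \<omega>))"
    using b by (simp add: mult.assoc)
  have "of_real v powr \<alpha>0 = of_real x powr \<alpha>0 * complex_of_real (norm (p (of_real t)) powr (1 / \<beta>0)) powr \<alpha>0"
    using x np unfolding v_def of_real_mult by (intro powr_times_real) auto
  also have "complex_of_real (norm (p (of_real t)) powr (1 / \<beta>0)) powr \<alpha>0 = of_real (norm (p (of_real t))) powr (\<alpha>0 / of_real \<beta>0)"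
    using np by (simp add: powr_def Ln_of_real ln_powr mult_ac exp_of_real flip: of_real_mult)
  finally have va: "of_real v powr \<alpha>0 = of_real x powr \<alpha>0 * of_real (norm (p (of_real t))) powr (\<alpha>0 / of_real \<beta>0)" .
  have "complex_of_real (norm (p (of_real t))) powr (\<alpha>0 / of_real \<beta>0) \<noteq> 0"
    using np by (simp add: powr_def)
  then show "a t = of_real v powr \<alpha>0 * (q (of_real t) / branch_powr t0 T \<beta>0 p (\<alpha>0 / of_real \<beta>0) (of_real t))"
    unfolding a B e2 va segment_powr_def ab \<omega>_def[symmetric]
    by (simp add: exp_minus field_simps)
qed

text \<open>The factorization in the coordinate \<open>v = \<psi>^(1 / \<beta>0)\<close>, with a remainder of order
  \<open>x^M\<close> relative to \<open>v^\<alpha>0\<close>.  The function \<open>v\<close> is the restriction to the segment of the analytic function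
  \<open>V(\<xi>) = \<xi> p^(1 / \<beta>0)\<close>, hence \<open>v' = \<sigma> V'\<close>; this is where the factor \<open>\<sigma> = exp (\<i> \<omega>)\<close> of the
  expansion comes from.\<close>

lemma local_real_expansion:
  fixes t0 :: real and M :: nat
  assumes T: "T \<noteq> ereal t0"
    and F: "factorization_condition t0 T a \<psi> R \<alpha>0 \<beta>0 q p"
  defines "\<sigma> \<equiv> segment_sign t0 T"
  obtains \<delta> c1 c2 C :: real and v v' :: "real \<Rightarrow> real" where
    "\<delta> > 0" "c1 > 0" "c2 > 0"
    "\<And>x. 0 < x \<Longrightarrow> x < \<delta> \<Longrightarrow> t0 + \<sigma> * x \<in> segment_from t0 T"
    "\<And>x. 0 < x \<Longrightarrow> x < \<delta> \<Longrightarrow> \<psi> (t0 + \<sigma> * x) = v x powr \<beta>0"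
    "\<And>x. 0 < x \<Longrightarrow> x < \<delta> \<Longrightarrow> (v has_real_derivative v' x) (at x)"
    "continuous_on {0<..<\<delta>} v'"
    "\<And>x. 0 < x \<Longrightarrow> x < \<delta> \<Longrightarrow> \<bar>v' x\<bar> \<le> C"
    "\<And>x. 0 < x \<Longrightarrow> x < \<delta> \<Longrightarrow> c1 * x \<le> v x \<and> v x \<le> c2 * x"
    "\<And>x. 0 < x \<Longrightarrow> x < \<delta> \<Longrightarrow> norm (a (t0 + \<sigma> * x) - of_real (v x) powr \<alpha>0 *
        (\<Sum>m<M. of_real \<beta>0 * (of_real \<sigma> * coeff_c t0 T \<alpha>0 \<beta>0 q p m) * of_real (v x ^ m * v' x)))
      \<le> C * x ^ M * v x powr Re \<alpha>0"
proof -
  let ?B = "branch_powr t0 T \<beta>0 p" and ?t = "complex_of_real t0"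
  have R: "R > 0" and p0: "p ?t \<noteq> 0" and b: "\<beta>0 > 0"
    using F by (auto simp: factorization_condition_def)
  have s1: "\<bar>\<sigma>\<bar> = 1" "\<sigma> * \<sigma> = 1" "\<sigma> \<noteq> 0" by (simp_all add: \<sigma>_def)
  define R1 where "R1 = (\<lambda>\<xi>. ?B (1 / of_real \<beta>0) (?t + \<xi>))"
  define V where "V = (\<lambda>\<xi>. \<xi> * R1 \<xi>)"
  define Q where "Q = (\<lambda>\<xi>. q (?t + \<xi>) / ?B (\<alpha>0 / of_real \<beta>0) (?t + \<xi>))"
  define d where "d = (\<lambda>m. of_real \<sigma> * coeff_c t0 T \<alpha>0 \<beta>0 q p m)"
  obtain D where "eventually (\<lambda>\<xi>. norm (Q \<xi>
      - (\<Sum>m<M. of_real \<beta>0 * coeff_c t0 T \<alpha>0 \<beta>0 q p m * (V \<xi> ^ m * deriv V \<xi>)))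
      \<le> D * norm \<xi> ^ M) (nhds 0)"
    using lagrange_remainder_bound[OF T F] unfolding Q_def V_def R1_def by blast
  then obtain e1 where e1: "e1 > 0" "\<And>\<xi>. norm \<xi> < e1 \<Longrightarrow> norm (Q \<xi>
      - (\<Sum>m<M. of_real \<beta>0 * coeff_c t0 T \<alpha>0 \<beta>0 q p m * (V \<xi> ^ m * deriv V \<xi>)))
      \<le> D * norm \<xi> ^ M"
    unfolding eventually_nhds_metric dist_norm by auto
  have Ba: "?B (1 / of_real \<beta>0) analytic_on {?t + 0}"
    using branch_powr_analytic[OF T F] by simp
  have "(?B (1 / of_real \<beta>0) \<circ> (\<lambda>\<xi>. ?t + \<xi>)) analytic_on {0}"
    by (rule analytic_on_compose_gen[OF _ Ba]) (auto intro!: analytic_intros)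
  then have R1a: "R1 analytic_on {0}" by (simp add: R1_def o_def)
  then obtain e2 where e2: "e2 > 0" "R1 holomorphic_on ball 0 e2"
    by (auto simp: analytic_on_def)
  have Vh: "V holomorphic_on ball 0 e2"
    unfolding V_def using e2 by (intro holomorphic_intros)
  then have V'h: "deriv V holomorphic_on ball 0 e2"
    by (intro holomorphic_deriv) auto
  have cont0: "isCont (\<lambda>\<xi>. norm (R1 \<xi>)) 0"
    using analytic_at_imp_isCont[OF R1a] by (intro continuous_intros)
  define r0 where "r0 = norm (R1 0)"
  have r0: "r0 > 0" using branch_powr_nonzero[where p = p and w = ?t, OF p0] by (simp add: r0_def R1_def)
  obtain e3 where e3: "e3 > 0" "\<And>\<xi>. norm \<xi> < e3 \<Longrightarrow> r0 / 2 \<le> norm (R1 \<xi>) \<and> norm (R1 \<xi>) \<le> 2 * r0"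
  proof -
    obtain e where e: "e > 0" "\<And>\<xi>. norm \<xi> < e \<Longrightarrow> \<bar>norm (R1 \<xi>) - r0\<bar> < r0 / 2"
      using cont0[unfolded continuous_at_eps_delta, rule_format, of "r0 / 2"] r0
      by (auto simp: dist_real_def r0_def)
    show ?thesis
    proof (rule that[OF e(1)])
      fix \<xi> :: complex assume "norm \<xi> < e"
      from e(2)[OF this] show "r0 / 2 \<le> norm (R1 \<xi>) \<and> norm (R1 \<xi>) \<le> 2 * r0"
        using r0 by linarith
    qed
  qed
  obtain t1 where t1: "t1 \<in> segment_from t0 T" "\<bar>t1 - t0\<bar> < R"
    using segment_near_start[OF T R] by blast
  define e4 where "e4 = \<bar>t1 - t0\<bar>"
  have e4: "e4 > 0" using segment_param_eq(2)[OF t1(1)] by (simp add: e4_def)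
  \<comment> \<open>Half of \<open>e2\<close>, so that the derivative of \<open>V\<close> is bounded on a compact disc.\<close>
  define \<delta> where "\<delta> = min (min e1 (e2 / 2)) (min e3 (min e4 R))"
  have \<delta>: "\<delta> > 0" using e1 e2 e3 e4 R by (simp add: \<delta>_def)
  have "compact (deriv V ` cball 0 (e2 / 2))"
    using V'h e2(1) by (intro compact_continuous_image holomorphic_on_imp_continuous_on)
      (auto intro: holomorphic_on_subset)
  then obtain K where K: "\<And>\<xi>. norm \<xi> \<le> e2 / 2 \<Longrightarrow> norm (deriv V \<xi>) \<le> K"
    by (meson bounded_iff compact_imp_bounded image_eqI mem_cball_0)
  define v where "v = (\<lambda>x. x * norm (p (of_real (t0 + \<sigma> * x))) powr (1 / \<beta>0))"
  define v' where "v' = (\<lambda>x. Re (of_real \<sigma> * deriv V (of_real (\<sigma> * x))))"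
  have mem: "t0 + \<sigma> * x \<in> segment_from t0 T" if "0 < x" "x < \<delta>" for x
    using segment_param_mem[OF t1(1) that(1)] that(2) by (simp add: \<delta>_def e4_def \<sigma>_def)
  have val: "v x > 0" "\<psi> (t0 + \<sigma> * x) = v x powr \<beta>0"
      "V (of_real (\<sigma> * x)) = of_real (v x)" 
      "a (t0 + \<sigma> * x) = of_real (v x) powr \<alpha>0 * Q (of_real (\<sigma> * x))"
    if x: "0 < x" "x < \<delta>" for x
  proof -
    have xR: "x < R" using x by (simp add: \<delta>_def)
    note rb = real_branch_values[OF T F x(1) xR mem[OF x, unfolded \<sigma>_def], folded \<sigma>_def]
    show "v x > 0" "\<psi> (t0 + \<sigma> * x) = v x powr \<beta>0"
      "V (of_real (\<sigma> * x)) = of_real (v x)" 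
      "a (t0 + \<sigma> * x) = of_real (v x) powr \<alpha>0 * Q (of_real (\<sigma> * x))"
      using rb by (simp_all add: v_def V_def Q_def R1_def)
  qed
  have ns: "norm (complex_of_real (\<sigma> * x)) = x" if "0 < x" for x
    using that s1 by (simp add: norm_mult abs_mult)
  have dV: "((\<lambda>x. V (of_real (\<sigma> * x))) has_vector_derivative of_real \<sigma> * deriv V (of_real (\<sigma> * x))) (at x)"
    if x: "0 < x" "x < \<delta>" for x
  proof -
    have "complex_of_real (\<sigma> * x) \<in> ball 0 e2" using ns[OF x(1)] x by (simp add: \<delta>_def)
    then have "(V has_field_derivative deriv V (of_real (\<sigma> * x))) (at (of_real (\<sigma> * x)))"
      using Vh by (intro holomorphic_derivI[of _ "ball 0 e2"]) auto
    moreover have "((\<lambda>x. complex_of_real (\<sigma> * x)) has_vector_derivative of_real \<sigma>) (at x)"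
      by (auto intro!: derivative_eq_intros simp: has_vector_derivative_def scaleR_conv_of_real)
    ultimately show ?thesis
      by (intro field_vector_diff_chain_at[unfolded o_def])
  qed
  have ev: "eventually (\<lambda>y. y \<in> {0<..<\<delta>}) (nhds x)" if "0 < x" "x < \<delta>" for x
    using that by (intro eventually_nhds_in_open) auto
  have dv: "(v has_real_derivative v' x) (at x)" if x: "0 < x" "x < \<delta>" for x
  proof -
    have "((\<lambda>x. Re (V (of_real (\<sigma> * x)))) has_vector_derivative v' x) (at x)"
      unfolding v'_def by (rule bounded_linear.has_vector_derivative[OF bounded_linear_Re dV[OF x]])
    then have *: "((\<lambda>x. Re (V (of_real (\<sigma> * x)))) has_real_derivative v' x) (at x)"
      by (simp add: has_real_derivative_iff_has_vector_derivative)
    have "eventually (\<lambda>y. Re (V (of_real (\<sigma> * y))) = v y) (nhds x)"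
      using ev[OF x] by eventually_elim (simp only: val greaterThanLessThan_iff Re_complex_of_real)
    from DERIV_cong_ev[OF refl this refl] * show ?thesis by (rule iffD1)
  qed
  have V'v: "deriv V (of_real (\<sigma> * x)) = of_real (\<sigma> * v' x)" if x: "0 < x" "x < \<delta>" for x
  proof -
    have "((\<lambda>x. complex_of_real (v x)) has_vector_derivative of_real (v' x)) (at x)"
      using dv[OF x] by (intro has_vector_derivative_of_real) (simp add: has_real_derivative_iff_has_vector_derivative)
    moreover have "((\<lambda>x. complex_of_real (v x)) has_vector_derivative of_real \<sigma> * deriv V (of_real (\<sigma> * x))) (at x)"
    proof (rule has_vector_derivative_transform_within_open[OF dV[OF x]])
      show "open {0<..<\<delta>}" "x \<in> {0<..<\<delta>}" using x by auto
      show "V (of_real (\<sigma> * y)) = complex_of_real (v y)" if "y \<in> {0<..<\<delta>}" for y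
        using that by (intro val) auto
    qed
    ultimately have "of_real \<sigma> * deriv V (of_real (\<sigma> * x)) = complex_of_real (v' x)"
      by (rule vector_derivative_unique_at[symmetric])
    then have "of_real \<sigma> * (of_real \<sigma> * deriv V (of_real (\<sigma> * x))) = of_real \<sigma> * complex_of_real (v' x)" by simp
    then show ?thesis
      using s1(2) by (simp add: mult.assoc[symmetric] flip: of_real_mult)
  qed
  show ?thesis
  proof (rule that[of \<delta> "r0 / 2" "2 * r0" v v' "max K D"])
    show "continuous_on {0<..<\<delta>} v'"
    proof -
      have "continuous_on {0<..<\<delta>} (\<lambda>x. deriv V (of_real (\<sigma> * x)))"
      proof (rule continuous_on_compose2[OF holomorphic_on_imp_continuous_on[OF V'h]])
        show "(\<lambda>x. complex_of_real (\<sigma> * x)) ` {0<..<\<delta>} \<subseteq> ball 0 e2"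
        proof (rule image_subsetI)
          fix x assume "x \<in> {0<..<\<delta>}"
          then show "complex_of_real (\<sigma> * x) \<in> ball 0 e2" using ns[of x] by (simp add: \<delta>_def)
        qed
      qed (intro continuous_intros)
      then show ?thesis unfolding v'_def by (intro continuous_intros)
    qed
    fix x assume x: "0 < x" "x < \<delta>"
    note n = ns[OF x(1)]
    show "\<bar>v' x\<bar> \<le> max K D"
    proof -
      have "norm (deriv V (of_real (\<sigma> * x))) \<le> K"
        using n x by (intro K) (simp add: \<delta>_def)
      then have "\<bar>v' x\<bar> \<le> K" unfolding V'v[OF x] norm_of_real abs_mult s1 by simp
      then show ?thesis by simp
    qed
    have "v x = norm (V (of_real (\<sigma> * x)))" using val(1)[OF x] unfolding val(3)[OF x] by simp
    also have "\<dots> = x * norm (R1 (of_real (\<sigma> * x)))" unfolding V_def norm_mult n ..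
    finally have vx: "v x = x * norm (R1 (of_real (\<sigma> * x)))" .
    have "r0 / 2 \<le> norm (R1 (of_real (\<sigma> * x))) \<and> norm (R1 (of_real (\<sigma> * x))) \<le> 2 * r0"
      using n x by (intro e3) (simp add: \<delta>_def)
    then show "r0 / 2 * x \<le> v x \<and> v x \<le> 2 * r0 * x"
      unfolding vx using x(1) by (simp add: mult.commute mult_left_mono)
    define X where "X = Q (of_real (\<sigma> * x)) - (\<Sum>m<M. of_real \<beta>0 * coeff_c t0 T \<alpha>0 \<beta>0 q p m *
         (V (of_real (\<sigma> * x)) ^ m * deriv V (of_real (\<sigma> * x))))"
    have "a (t0 + \<sigma> * x) - of_real (v x) powr \<alpha>0 * (\<Sum>m<M. of_real \<beta>0 * d m * of_real (v x ^ m * v' x))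
      = of_real (v x) powr \<alpha>0 * X"
      unfolding X_def val(4)[OF x] val(3)[OF x] V'v[OF x] d_def
      by (simp add: right_diff_distrib mult_ac)
    also have "norm \<dots> = v x powr Re \<alpha>0 * norm X"
      using val(1)[OF x] by (simp add: norm_mult norm_powr_real_powr)
    also have "\<dots> \<le> v x powr Re \<alpha>0 * (max K D * x ^ M)"
    proof (rule mult_left_mono)
      have "norm X \<le> D * x ^ M"
        using e1(2)[of "of_real (\<sigma> * x)"] n x unfolding X_def by (simp add: \<delta>_def)
      also have "\<dots> \<le> max K D * x ^ M" using x by (intro mult_right_mono) auto
      finally show "norm X \<le> max K D * x ^ M" .
    qed simp
    finally show "norm (a (t0 + \<sigma> * x) - of_real (v x) powr \<alpha>0 *
        (\<Sum>m<M. of_real \<beta>0 * (of_real \<sigma> * coeff_c t0 T \<alpha>0 \<beta>0 q p m) * of_real (v x ^ m * v' x)))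
      \<le> max K D * x ^ M * v x powr Re \<alpha>0" unfolding d_def by (simp add: mult_ac)
  qed (use \<delta> r0 mem val dv in auto)
qed

section \<open>The contribution of a neighbourhood of the starting point\<close>

lemma tail_integral_has_vector_derivative:
  fixes f :: "real \<Rightarrow> complex"
  assumes cont: "continuous_on {0<..} f" and int: "set_integrable lborel {0<..} f" and u: "u > 0"
  shows "((\<lambda>u. LBINT s:{u<..}. f s) has_vector_derivative - f u) (at u)"
proof -
  define c where "c = u / 2"
  have c: "0 < c" "c < u" using u by (auto simp: c_def)
  have "((\<lambda>w. LBINT y=c..w. f y) has_vector_derivative f u) (at u within {c..u + 1})"
    using c by (intro interval_integral_FTC2) (auto intro: continuous_on_subset[OF cont])
  then have "((\<lambda>w. LBINT y=c..w. f y) has_vector_derivative f u) (at u)"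
    using c by (simp add: at_within_Icc_at)
  then have d: "((\<lambda>w. (LBINT s:{c<..}. f s) - (LBINT y=c..w. f y)) has_vector_derivative 0 - f u) (at u)"
    by (intro has_vector_derivative_diff has_vector_derivative_const)
  have "((\<lambda>u. LBINT s:{u<..}. f s) has_vector_derivative 0 - f u) (at u)"
  proof (rule has_vector_derivative_transform_within_open[OF d])
    show "open {c<..}" "u \<in> {c<..}" using c by auto
    fix w assume "w \<in> {c<..}"
    then have w: "c \<le> w" by simp
    have "(LBINT s:{c<..w} \<union> {w<..}. f s) = (LBINT s:{c<..w}. f s) + (LBINT s:{w<..}. f s)"
      using c w by (intro set_integral_Un) (auto intro: set_integrable_subset[OF int])
    moreover have "{c<..w} \<union> {w<..} = {c<..}" using w by auto
    moreover have "(LBINT y=c..w. f y) = (LBINT s:{c<..w}. f s)"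
      using w by (rule interval_integral_Ioc)
    ultimately show "(LBINT s:{c<..}. f s) - (LBINT y=c..w. f y) = (LBINT s:{w<..}. f s)" by simp
  qed
  then show ?thesis by simp
qed

lemma tail_integral_tendsto_0:
  fixes f :: "real \<Rightarrow> complex"
  assumes int: "set_integrable lborel {0<..} f"
  shows "((\<lambda>u. LBINT s:{u<..}. f s) \<longlongrightarrow> 0) at_top"
proof -
  define I where "I = (LBINT s:{0<..}. f s)"
  have "((\<lambda>u. LBINT s. indicator {..u} s *\<^sub>R (indicator {0<..} s *\<^sub>R f s)) \<longlongrightarrow> I) at_top"
    unfolding I_def set_lebesgue_integral_def using int
    by (intro tendsto_integral_at_top) (auto simp: set_integrable_def)
  then have lim: "((\<lambda>u. I - (LBINT s. indicator {..u} s *\<^sub>R (indicator {0<..} s *\<^sub>R f s))) \<longlongrightarrow> I - I) at_top"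
    by (intro tendsto_intros)
  have "eventually (\<lambda>u. I - (LBINT s. indicator {..u} s *\<^sub>R (indicator {0<..} s *\<^sub>R f s)) = (LBINT s:{u<..}. f s)) at_top"
    using eventually_ge_at_top[of 0]
  proof eventually_elim
    case (elim u)
    have "(LBINT s:{0<..u} \<union> {u<..}. f s) = (LBINT s:{0<..u}. f s) + (LBINT s:{u<..}. f s)"
      using elim by (intro set_integral_Un) (auto intro: set_integrable_subset[OF int])
    moreover have "{0<..u} \<union> {u<..} = {0<..}" using elim by auto
    moreover have "(LBINT s. indicator {..u} s *\<^sub>R (indicator {0<..} s *\<^sub>R f s)) = (LBINT s:{0<..u}. f s)"
      unfolding set_lebesgue_integral_def
      by (intro Bochner_Integration.integral_cong) (auto simp: indicator_def)
    ultimately show ?case by (simp add: I_def)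
  qed
  with lim show ?thesis by (simp add: tendsto_cong)
qed

text \<open>The substitution \<open>s = S x\<close>, where \<open>S\<close> comes down from infinity as \<open>x\<close> leaves \<open>0\<close>.  Instead of
  monotonicity of \<open>S\<close> it uses that the tail integral of \<open>f\<close>, composed with \<open>S\<close>, is an
  antiderivative.\<close>

lemma integral_substitution_from_infinity:
  fixes f :: "real \<Rightarrow> complex" and S S' :: "real \<Rightarrow> real"
  assumes f: "continuous_on {0<..} f" "set_integrable lborel {0<..} f"
    and d: "0 < d" "d < d'"
    and S: "\<And>x. 0 < x \<Longrightarrow> x < d' \<Longrightarrow> (S has_real_derivative S' x) (at x)"
    and pos: "\<And>x. 0 < x \<Longrightarrow> x < d' \<Longrightarrow> S x > 0"
    and S': "continuous_on {0<..<d} S'"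
    and lim: "filterlim S at_top (at_right 0)"
    and int: "set_integrable lborel {0<..<d} (\<lambda>x. f (S x) * of_real (- S' x))"
  shows "(LBINT x:{0<..<d}. f (S x) * of_real (- S' x)) = (LBINT s:{S d<..}. f s)"
proof -
  define G where "G = (\<lambda>u. LBINT s:{u<..}. f s)"
  have G: "((\<lambda>x. G (S x)) has_vector_derivative f (S x) * of_real (- S' x)) (at x)" if x: "0 < x" "x < d'" for x
  proof -
    have "(S has_vector_derivative S' x) (at x)"
      using S[OF x] by (simp add: has_real_derivative_iff_has_vector_derivative)
    moreover have "(G has_vector_derivative - f (S x)) (at (S x))"
      unfolding G_def by (rule tail_integral_has_vector_derivative[OF f pos[OF x]])
    ultimately have "((G \<circ> S) has_vector_derivative S' x *\<^sub>R (- f (S x))) (at x)"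
      by (rule vector_diff_chain_at)
    then show ?thesis by (simp add: o_def scaleR_conv_of_real mult.commute)
  qed
  have cS: "isCont S x" if "0 < x" "x < d'" for x
    using S[OF that] by (rule DERIV_isCont)
  have "(LBINT x:{0<..<d}. f (S x) * of_real (- S' x)) = G (S d) - 0"
  proof (rule integral_FTC_open_interval[OF d(1) _ _ int])
    show "((\<lambda>x. G (S x)) has_vector_derivative f (S x) * of_real (- S' x)) (at x)" if "0 < x" "x < d" for x
      using G[of x] that d by simp
    have "continuous_on {0<..<d} (\<lambda>x. f (S x))"
    proof (rule continuous_on_compose2[OF f(1)])
      show "continuous_on {0<..<d} S"
        using cS d by (intro continuous_at_imp_continuous_on) auto
      show "S ` {0<..<d} \<subseteq> {0<..}" using pos d by auto
    qed
    then show "continuous_on {0<..<d} (\<lambda>x. f (S x) * of_real (- S' x))"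
      using S' by (intro continuous_intros)
    show "((\<lambda>x. G (S x)) \<longlongrightarrow> 0) (at_right 0)"
      using tail_integral_tendsto_0[OF f(2)] lim unfolding G_def by (rule filterlim_compose)
    have "isCont (\<lambda>x. G (S x)) d"
      using G[OF d] by (rule has_vector_derivative_continuous)
    then show "((\<lambda>x. G (S x)) \<longlongrightarrow> G (S d)) (at_left d)"
      unfolding isCont_def by (rule tendsto_within_subset) simp
  qed
  then show ?thesis by (simp add: G_def)
qed

lemma continuous_on_tricomi_integrand: "continuous_on {0<..} (tricomi_integrand x z)"
  unfolding tricomi_integrand_def by (intro continuous_intros) auto

lemma tricomi_kernel_le_1: "(s::real) > 0 \<Longrightarrow> x \<ge> 0 \<Longrightarrow> (s / (1 + s)) powr x \<le> 1"
  using powr_mono2[of x "s / (1 + s)" 1] by simp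

lemma norm_tricomi_integrand_le:
  assumes "s > 0" "x \<ge> 0"
  shows "norm (tricomi_integrand x z s) \<le> exp (- Re z * s)"
  using tricomi_kernel_le_1[OF assms]
  by (simp add: tricomi_integrand_def norm_mult mult_left_le)

lemma set_integrable_tricomi_integrand:
  assumes "x \<ge> 0" "Re z > 0"
  shows "set_integrable lborel {0<..} (tricomi_integrand x z)"
  by (rule set_integrable_lborel_bound[OF set_integrable_exp_decay[OF assms(2)] _ continuous_on_tricomi_integrand])
     (use norm_tricomi_integrand_le assms in auto)

text \<open>Cutting the integral for \<open>\<Phi>\<close> at \<open>s1\<close> costs an exponentially small amount, because
  \<open>s / (1 + s)\<close> is increasing and less than 1.\<close>

lemma tricomi_Phi_tail:
  assumes s1: "s1 > 0" and x: "x \<ge> 0" and z: "Re z > 0"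
  shows "norm (tricomi_Phi x z - (LBINT s:{s1<..}. tricomi_integrand x z s)) \<le> s1 * (s1 / (1 + s1)) powr x"
proof -
  note int = set_integrable_tricomi_integrand[OF x z]
  have int1: "set_integrable lborel {0<..s1} (tricomi_integrand x z)"
    by (rule set_integrable_subset[OF int]) (use s1 in auto)
  have "(LBINT s:{0<..s1} \<union> {s1<..}. tricomi_integrand x z s) =
      (LBINT s:{0<..s1}. tricomi_integrand x z s) + (LBINT s:{s1<..}. tricomi_integrand x z s)"
    using s1 int1 by (intro set_integral_Un) (auto intro: set_integrable_subset[OF int])
  moreover have "{0<..s1} \<union> {s1<..} = {0<..}" using s1 by auto
  ultimately have "tricomi_Phi x z - (LBINT s:{s1<..}. tricomi_integrand x z s) = (LBINT s:{0<..s1}. tricomi_integrand x z s)"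
    by (simp add: tricomi_Phi_def)
  also have "norm \<dots> \<le> (LBINT s:{0<..s1}. norm (tricomi_integrand x z s))"
    using int1 by (rule set_integral_norm_bound)
  also have "\<dots> \<le> (LBINT s:{0<..s1}. (s1 / (1 + s1)) powr x)"
  proof (rule set_integral_mono)
    show "set_integrable lborel {0<..s1} (\<lambda>s. norm (tricomi_integrand x z s))"
      using int1 by (rule set_integrable_norm)
    show "set_integrable lborel {0<..s1} (\<lambda>s. (s1 / (1 + s1)) powr x)"
    proof -
      have "integrable lborel (indicat_real {0<..s1})"
        using s1 by (intro integrable_real_indicator) (auto simp: emeasure_lborel_Ioc)
      then show ?thesis unfolding set_integrable_def by simp
    qed
    fix s assume s: "s \<in> {0<..s1}"
    have "s / (1 + s) \<le> s1 / (1 + s1)" using s by (simp add: field_simps)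
    then have "(s / (1 + s)) powr x \<le> (s1 / (1 + s1)) powr x"
      using s x by (intro powr_mono2) auto
    moreover have "exp (- (Re z * s)) \<le> 1" using s z by simp
    ultimately have "exp (- (Re z * s)) * (s / (1 + s)) powr x \<le> 1 * (s1 / (1 + s1)) powr x"
      by (intro mult_mono) auto
    then show "norm (tricomi_integrand x z s) \<le> (s1 / (1 + s1)) powr x"
      by (simp add: tricomi_integrand_def norm_mult)
  qed
  also have "\<dots> = s1 * (s1 / (1 + s1)) powr x"
    using s1 by (simp add: set_lebesgue_integral_def)
  finally show ?thesis .
qed

text \<open>From \<open>ln (s / (1 + s)) \<le> - 1 / (1 + s)\<close> and the inequality of the means for \<open>x / (1 + s)\<close> and
  \<open>g (1 + s)\<close>.\<close>

lemma tricomi_kernel_exp_bound: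
  assumes s: "s > 0" and x: "x \<ge> 0" and g: "g \<ge> 0"
  shows "(s / (1 + s)) powr x * exp (- (g * s)) \<le> exp g * exp (- 2 * sqrt (x * g))"
proof -
  have "ln (s / (1 + s)) \<le> s / (1 + s) - 1" using s by (intro ln_le_minus_one) auto
  also have "\<dots> = - (1 / (1 + s))" using s by (simp add: field_simps)
  finally have "x * ln (s / (1 + s)) \<le> x * (- (1 / (1 + s)))" using x by (rule mult_left_mono)
  then have 1: "x * ln (s / (1 + s)) - g * s \<le> - (x / (1 + s) + g * (1 + s)) + g"
    by (simp add: algebra_simps)
  define A where "A = sqrt (x / (1 + s))"
  define B where "B = sqrt (g * (1 + s))"
  have "A * B = sqrt (x * g)" unfolding A_def B_def using s by (simp flip: real_sqrt_mult)
  moreover have "A\<^sup>2 = x / (1 + s)" "B\<^sup>2 = g * (1 + s)" using s x g by (simp_all add: A_def B_def)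
  moreover have "0 \<le> (A - B)\<^sup>2" by simp
  ultimately have "2 * sqrt (x * g) \<le> x / (1 + s) + g * (1 + s)"
    by (simp add: power2_diff)
  with 1 have "x * ln (s / (1 + s)) - g * s \<le> g - 2 * sqrt (x * g)" by linarith
  then have "exp (x * ln (s / (1 + s)) - g * s) \<le> exp (g - 2 * sqrt (x * g))" by simp
  then show ?thesis using s by (simp add: powr_def exp_diff exp_minus divide_inverse)
qed

lemma set_integrable_powr_near_0:
  assumes "r > (- 1 :: real)" "d > 0"
  shows "set_integrable lborel {0<..<d} (\<lambda>x. x powr r)"
proof -
  have "(\<lambda>x. x powr r) absolutely_integrable_on {0..d}"
    using integrable_on_powr_from_0[OF assms(1), of d] assms(2)
    by (intro nonnegative_absolutely_integrable_1) auto
  then have "set_integrable lebesgue {0<..<d} (\<lambda>x. x powr r)"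
    by (rule set_integrable_subset) auto
  then show ?thesis
    unfolding set_integrable_def
    by (subst (asm) integrable_completion) auto
qed

lemma powr_comparable:
  fixes x v c1 c2 r :: real
  assumes "0 < c1" "0 < x" "c1 * x \<le> v" "v \<le> c2 * x"
  shows "v powr r \<le> max (c1 powr r) (c2 powr r) * x powr r"
proof -
  define y where "y = v / x"
  have y: "c1 \<le> y" "y \<le> c2" "v = y * x" using assms by (simp_all add: y_def field_simps)
  have "y powr r \<le> max (c1 powr r) (c2 powr r)"
  proof (cases "r \<ge> 0")
    case True
    then have "y powr r \<le> c2 powr r" using y assms by (intro powr_mono2) auto
    then show ?thesis by simp
  next
    case False
    then have "y powr r \<le> c1 powr r" using y assms by (intro powr_mono2') auto
    then show ?thesis by simp
  qed
  moreover have "v powr r = y powr r * x powr r"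
    unfolding y(3) using y assms by (intro powr_mult)
  ultimately show ?thesis by (simp add: mult_right_mono)
qed

text \<open>With \<open>s = S x = - \<beta>0 ln v\<close>, that is \<open>s = 1 / (exp \<phi> - 1)\<close>, one has \<open>exp (- \<phi>) = s / (1 + s)\<close>, and
  \<open>\<beta>0 v^(\<alpha>0 + m) v' dx = - exp (- \<chi>\<^sub>m s) ds\<close>.  So the terms of the local expansion integrate to
  tails of \<open>\<Phi>\<close>.  In the remainder, \<open>x^M\<close> is at most a multiple of \<open>v^M = exp (- (M / \<beta>0) s)\<close>,
  whose product with the kernel is bounded by a multiple of
  \<open>exp (- 2 sqrt (l M / \<beta>0))\<close> uniformly in \<open>s\<close>.\<close>

lemma near_integral_expansion:
  fixes t0 :: real and T :: ereal and \<phi> :: "real \<Rightarrow> real" and M :: nat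
  defines "P \<equiv> segment_from t0 T" and "\<sigma> \<equiv> segment_sign t0 T"
  defines "\<psi> \<equiv> (\<lambda>t. exp (1 - inverse (1 - exp (- \<phi> t))))"
  assumes T: "T \<noteq> ereal t0"
    and a: "continuous_on P a"
    and \<phi>: "\<And>t. t \<in> P \<Longrightarrow> \<phi> t > 0"
    and F: "factorization_condition t0 T a \<psi> R \<alpha>0 \<beta>0 q p"
  obtains \<delta> s1 C where "\<delta> > 0" "s1 > 0" "\<And>x. 0 < x \<Longrightarrow> x < \<delta> \<Longrightarrow> t0 + \<sigma> * x \<in> P"
    "\<And>l. l \<ge> 0 \<Longrightarrow>
      norm ((LBINT x:{0<..<\<delta>}. of_real (exp (- l * \<phi> (t0 + \<sigma> * x))) * a (t0 + \<sigma> * x)) -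
        (\<Sum>m<M. (LBINT s:{s1<..}. tricomi_integrand l (chi \<alpha>0 \<beta>0 m) s) * (of_real \<sigma> * coeff_c t0 T \<alpha>0 \<beta>0 q p m)))
      \<le> C * exp (- 2 * sqrt (real M / \<beta>0) * sqrt l)"
proof -
  have b: "\<beta>0 > 0" and al: "Re \<alpha>0 > -1" using F by (auto simp: factorization_condition_def)
  define d where "d = (\<lambda>m. of_real \<sigma> * coeff_c t0 T \<alpha>0 \<beta>0 q p m)"
  obtain \<delta>0 c1 c2 C v v' where \<delta>0: "\<delta>0 > 0" and c: "c1 > 0" "c2 > 0"
    and mem: "\<And>x. 0 < x \<Longrightarrow> x < \<delta>0 \<Longrightarrow> t0 + \<sigma> * x \<in> P"
    and psi: "\<And>x. 0 < x \<Longrightarrow> x < \<delta>0 \<Longrightarrow> \<psi> (t0 + \<sigma> * x) = v x powr \<beta>0"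
    and dv: "\<And>x. 0 < x \<Longrightarrow> x < \<delta>0 \<Longrightarrow> (v has_real_derivative v' x) (at x)"
    and cv': "continuous_on {0<..<\<delta>0} v'"
    and bv': "\<And>x. 0 < x \<Longrightarrow> x < \<delta>0 \<Longrightarrow> \<bar>v' x\<bar> \<le> C"
    and vx: "\<And>x. 0 < x \<Longrightarrow> x < \<delta>0 \<Longrightarrow> c1 * x \<le> v x \<and> v x \<le> c2 * x"
    and rem: "\<And>x. 0 < x \<Longrightarrow> x < \<delta>0 \<Longrightarrow> norm (a (t0 + \<sigma> * x) - of_real (v x) powr \<alpha>0 *
        (\<Sum>m<M. of_real \<beta>0 * d m * of_real (v x ^ m * v' x)))
      \<le> C * x ^ M * v x powr Re \<alpha>0"
    unfolding d_def \<sigma>_def P_def by (rule local_real_expansion[OF T F, where M = M]) blast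
  \<comment> \<open>Less than \<open>\<delta>0\<close>, so that \<open>S\<close> is still differentiable at the right end.\<close>
  define \<delta> where "\<delta> = \<delta>0 / 2"
  have \<delta>: "0 < \<delta>" "\<delta> < \<delta>0" using \<delta>0 by (simp_all add: \<delta>_def)
  have C0: "C \<ge> 0" using bv'[OF \<delta>] by linarith
  have vpos: "v x > 0" if "0 < x" "x < \<delta>0" for x
    using vx[OF that] c mult_pos_pos[OF c(1) that(1)] by linarith
  define S where "S = (\<lambda>x. - \<beta>0 * ln (v x))"
  define S' where "S' = (\<lambda>x. - \<beta>0 * (v' x / v x))"
  have S: "S x > 0" "S x / (1 + S x) = exp (- \<phi> (t0 + \<sigma> * x))" if x: "0 < x" "x < \<delta>0" for x
  proof -
    define E where "E = exp (- \<phi> (t0 + \<sigma> * x))"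
    have E: "0 < E" "E < 1" using \<phi>[OF mem[OF x]] by (simp_all add: E_def)
    have "exp (\<beta>0 * ln (v x)) = \<psi> (t0 + \<sigma> * x)"
      using psi[OF x] vpos[OF x] by (simp add: powr_def)
    then have "exp (- S x) = exp (1 - inverse (1 - E))" by (simp add: S_def \<psi>_def E_def)
    then have "S x = inverse (1 - E) - 1" by simp
    also have "\<dots> = E / (1 - E)" using E by (simp add: field_simps)
    finally have Sx: "S x = E / (1 - E)" .
    show "S x > 0" unfolding Sx using E by simp
    show "S x / (1 + S x) = exp (- \<phi> (t0 + \<sigma> * x))" unfolding Sx E_def[symmetric] using E by (simp add: field_simps)
  qed
  have dS: "(S has_real_derivative S' x) (at x)" if x: "0 < x" "x < \<delta>0" for x
    unfolding S_def S'_def using vpos[OF x] by (auto intro!: derivative_eq_intros dv[OF x] simp: field_simps)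
  have contv: "continuous_on {0<..<\<delta>0} v"
    using DERIV_isCont[OF dv] by (intro continuous_at_imp_continuous_on) auto
  have contS: "continuous_on {0<..<\<delta>0} S"
    using DERIV_isCont[OF dS] by (intro continuous_at_imp_continuous_on) auto
  have contS': "continuous_on {0<..<\<delta>0} S'"
    unfolding S'_def using vpos by (intro continuous_intros cv' contv) fastforce
  have limS: "filterlim S at_top (at_right 0)"
  proof -
    have ev: "eventually (\<lambda>x. x \<in> {0<..<\<delta>0}) (at_right 0)"
      using eventually_at_right_real[OF \<delta>0] .
    have "(v \<longlongrightarrow> 0) (at_right 0)"
    proof (rule Lim_null_comparison)
      show "\<forall>\<^sub>F x in at_right 0. norm (v x) \<le> c2 * x"
        using ev by eventually_elim (use vx vpos in force)
      have "((\<lambda>x. c2 * x) \<longlongrightarrow> c2 * 0) (at_right 0)" by (intro tendsto_intros)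
      then show "((\<lambda>x. c2 * x) \<longlongrightarrow> 0) (at_right 0)" by simp
    qed
    moreover have "eventually (\<lambda>x. v x > 0) (at_right 0)"
      using ev by eventually_elim (use vpos in auto)
    ultimately have "filterlim v (at_right 0) (at_right 0)"
      unfolding filterlim_at by (auto elim: eventually_mono)
    then have "filterlim (\<lambda>x. ln (v x)) at_bot (at_right 0)"
      by (rule filterlim_compose[OF ln_at_0])
    then have "filterlim (\<lambda>x. \<beta>0 * (- ln (v x))) at_top (at_right 0)"
      using b by (intro filterlim_tendsto_pos_mult_at_top[OF tendsto_const])
        (auto simp: filterlim_uminus_at_bot[symmetric] filterlim_uminus_at_top)
    then show ?thesis by (simp add: S_def)
  qed
  define W where "W = max (c1 powr Re \<alpha>0) (c2 powr Re \<alpha>0)"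
  have W: "v x powr Re \<alpha>0 \<le> W * x powr Re \<alpha>0" if x: "0 < x" "x < \<delta>0" for x
    unfolding W_def using vx[OF x] c x by (intro powr_comparable) auto
  have W0: "W > 0" using c by (simp add: W_def less_max_iff_disj)
  define J where "J = (LBINT x:{0<..<\<delta>}. x powr Re \<alpha>0)"
  have intJ: "set_integrable lborel {0<..<\<delta>} (\<lambda>x. x powr Re \<alpha>0)"
    using al \<delta> by (intro set_integrable_powr_near_0) auto
  define g where "g = (\<lambda>l m x. tricomi_integrand l (chi \<alpha>0 \<beta>0 m) (S x) * of_real (- S' x))"
  define K where "K = (\<lambda>l x. exp (- l * \<phi> (t0 + \<sigma> * x)))"
  have K: "K l x = (S x / (1 + S x)) powr l" if "0 < x" "x < \<delta>0" for l x
    unfolding S(2)[OF that] K_def by (simp add: powr_def)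
  have g: "g l m x = of_real (K l x) * (of_real (v x) powr \<alpha>0 * (of_real \<beta>0 * of_real (v x ^ m * v' x)))"
    if x: "0 < x" "x < \<delta>0" for l m x
  proof -
    note v = vpos[OF x]
    have "- (chi \<alpha>0 \<beta>0 m * of_real (S x)) = (\<alpha>0 + 1 + of_nat m) * of_real (ln (v x))"
      using b by (simp add: chi_def S_def)
    also have "exp \<dots> = of_real (v x) powr \<alpha>0 * of_real (v x) powr of_nat (Suc m)"
      using v by (simp add: powr_def Ln_of_real exp_add[symmetric] algebra_simps)
    also have "of_real (v x) powr of_nat (Suc m) = complex_of_real (v x ^ Suc m)"
      using v by (subst powr_nat') auto
    finally have e: "exp (- (chi \<alpha>0 \<beta>0 m * of_real (S x))) = of_real (v x) powr \<alpha>0 * of_real (v x ^ Suc m)" .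
    have e': "complex_of_real (v x ^ Suc m) * of_real (- S' x) = of_real \<beta>0 * of_real (v x ^ m * v' x)"
      unfolding of_real_mult[symmetric] of_real_eq_iff using v by (simp add: S'_def)
    have "g l m x = of_real (K l x) * (of_real (v x) powr \<alpha>0 * (complex_of_real (v x ^ Suc m) * of_real (- S' x)))"
      unfolding g_def tricomi_integrand_def e K[OF x, symmetric] by (simp only: mult_ac)
    then show ?thesis unfolding e' .
  qed
  have Kpos: "K l x > 0" for l x by (simp add: K_def)
  have K1: "K l x \<le> 1" if "l \<ge> 0" "0 < x" "x < \<delta>0" for l x
    unfolding K[OF that(2,3)] using S(1)[OF that(2,3)] that(1) by (rule tricomi_kernel_le_1)
  have chi_pos: "Re (chi \<alpha>0 \<beta>0 m) > 0" for m
    using al b by (simp add: chi_def)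
  have contg: "continuous_on {0<..<\<delta>0} (g l m)" for l m
    unfolding g_def using S(1)
    by (intro continuous_intros contS' continuous_on_compose2[OF continuous_on_tricomi_integrand contS]) auto
  have intg: "set_integrable lborel {0<..<\<delta>} (g l m)" if l: "l \<ge> 0" for l m
  proof (rule set_integrable_lborel_bound[where f = "\<lambda>x. (W * (\<beta>0 * ((c2 * \<delta>) ^ m * C))) * x powr Re \<alpha>0"])
    show "set_integrable lborel {0<..<\<delta>} (\<lambda>x. (W * (\<beta>0 * ((c2 * \<delta>) ^ m * C))) * x powr Re \<alpha>0)"
      using intJ by simp
    show "continuous_on {0<..<\<delta>} (g l m)"
      using contg by (rule continuous_on_subset) (use \<delta> in auto)
    fix x assume "x \<in> {0<..<\<delta>}"
    then have x: "0 < x" "x < \<delta>0" "x < \<delta>" using \<delta> by auto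
    have "c2 * x \<le> c2 * \<delta>" using x c by simp
    then have "v x \<le> c2 * \<delta>" using vx[OF x(1,2)] by linarith
    then have vm: "v x ^ m \<le> (c2 * \<delta>) ^ m" using vpos[OF x(1,2)] by (intro power_mono) auto
    have "norm (g l m x) = K l x * (v x powr Re \<alpha>0 * (\<beta>0 * (v x ^ m * \<bar>v' x\<bar>)))"
      unfolding g[OF x(1,2)] using vpos[OF x(1,2)] b Kpos[of l x]
      by (simp add: norm_mult norm_power norm_powr_real_powr abs_mult)
    also have "\<dots> \<le> 1 * ((W * x powr Re \<alpha>0) * (\<beta>0 * ((c2 * \<delta>) ^ m * C)))"
      using K1[OF l x(1,2)] W[OF x(1,2)] vm bv'[OF x(1,2)] b C0 c \<delta> Kpos[of l x] W0 vpos[OF x(1,2)]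
      by (intro mult_mono mult_nonneg_nonneg) auto
    finally show "norm (g l m x) \<le> (W * (\<beta>0 * ((c2 * \<delta>) ^ m * C))) * x powr Re \<alpha>0"
      by (simp add: mult_ac)
  qed simp
  have g_int: "(LBINT x:{0<..<\<delta>}. g l m x) = (LBINT s:{S \<delta><..}. tricomi_integrand l (chi \<alpha>0 \<beta>0 m) s)" if l: "l \<ge> 0" for l m
    unfolding g_def
  proof (rule integral_substitution_from_infinity[where d' = \<delta>0])
    show "continuous_on {0<..<\<delta>} S'"
      using contS' by (rule continuous_on_subset) (use \<delta> in auto)
    show "set_integrable lborel {0<..} (tricomi_integrand l (chi \<alpha>0 \<beta>0 m))"
      using l chi_pos by (rule set_integrable_tricomi_integrand)
    show "set_integrable lborel {0<..<\<delta>} (\<lambda>x. tricomi_integrand l (chi \<alpha>0 \<beta>0 m) (S x) * complex_of_real (- S' x))"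
      using intg[OF l, of m] unfolding g_def .
  qed (use \<delta> dS S limS continuous_on_tricomi_integrand in auto)
  define \<gamma> where "\<gamma> = real M / \<beta>0"
  have \<gamma>: "\<gamma> \<ge> 0" using b by (simp add: \<gamma>_def)
  define h where "h = (\<lambda>l x. of_real (K l x) * a (t0 + \<sigma> * x) - (\<Sum>m<M. g l m x * d m))"
  define Z where "Z = C * (inverse c1 ^ M * (exp \<gamma> * W))"
  have h: "norm (h l x) \<le> Z * exp (- 2 * sqrt (l * \<gamma>)) * x powr Re \<alpha>0" if l: "l \<ge> 0" and x: "0 < x" "x < \<delta>0" for l x
  proof -
    have "h l x = of_real (K l x) * (a (t0 + \<sigma> * x) - of_real (v x) powr \<alpha>0 *
        (\<Sum>m<M. of_real \<beta>0 * d m * of_real (v x ^ m * v' x)))"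
      unfolding h_def g[OF x] by (simp add: right_diff_distrib sum_distrib_left mult_ac)
    also have "norm \<dots> \<le> K l x * (C * x ^ M * v x powr Re \<alpha>0)"
      unfolding norm_mult using rem[OF x] Kpos[of l x] by (simp add: mult_left_mono)
    also have "\<dots> \<le> K l x * (C * (inverse c1 ^ M * v x ^ M) * (W * x powr Re \<alpha>0))"
    proof -
      have "x \<le> inverse c1 * v x" using vx[OF x] c by (simp add: field_simps)
      then have "x ^ M \<le> (inverse c1 * v x) ^ M" using x by (intro power_mono) auto
      then have "x ^ M \<le> inverse c1 ^ M * v x ^ M" by (simp add: power_mult_distrib)
      then show ?thesis
        using W[OF x] C0 c vpos[OF x] Kpos[of l x] x
        by (intro mult_left_mono mult_mono mult_nonneg_nonneg) auto
    qed
    also have "\<dots> = (K l x * v x ^ M) * (C * inverse c1 ^ M * W * x powr Re \<alpha>0)" by simp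
    also have "\<dots> \<le> (exp \<gamma> * exp (- 2 * sqrt (l * \<gamma>))) * (C * inverse c1 ^ M * W * x powr Re \<alpha>0)"
    proof (rule mult_right_mono)
      have "v x ^ M = exp (- (\<gamma> * S x))"
        using vpos[OF x] b by (simp add: \<gamma>_def S_def powr_def flip: powr_realpow)
      then show "K l x * v x ^ M \<le> exp \<gamma> * exp (- 2 * sqrt (l * \<gamma>))"
        unfolding K[OF x] using tricomi_kernel_exp_bound[OF S(1)[OF x] l \<gamma>] by simp
    qed (use C0 c W0 in simp)
    finally show ?thesis by (simp add: Z_def mult_ac)
  qed
  have inth: "set_integrable lborel {0<..<\<delta>} (h l)" if l: "l \<ge> 0" for l
  proof (rule set_integrable_lborel_bound[where f = "\<lambda>x. Z * exp (- 2 * sqrt (l * \<gamma>)) * x powr Re \<alpha>0"])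
    show "set_integrable lborel {0<..<\<delta>} (\<lambda>x. Z * exp (- 2 * sqrt (l * \<gamma>)) * x powr Re \<alpha>0)"
      using intJ by simp
    have sub: "{0<..<\<delta>} \<subseteq> {0<..<\<delta>0}" using \<delta> by auto
    have ca: "continuous_on {0<..<\<delta>0} (\<lambda>x. a (t0 + \<sigma> * x))"
      by (rule continuous_on_compose2[OF a]) (auto intro!: continuous_intros mem)
    have cK0: "continuous_on {0<..<\<delta>0} (\<lambda>x. (S x / (1 + S x)) powr l)"
    proof (intro continuous_intros contS)
      show "\<forall>x\<in>{0<..<\<delta>0}. 1 + S x \<noteq> 0"
      proof
        fix x assume "x \<in> {0<..<\<delta>0}"
        then show "1 + S x \<noteq> 0" using S(1)[of x] by simp
      qed
      show "\<forall>x\<in>{0<..<\<delta>0}. S x / (1 + S x) \<noteq> 0"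
      proof
        fix x assume "x \<in> {0<..<\<delta>0}"
        then show "S x / (1 + S x) \<noteq> 0" using S(2)[of x] by (simp only: greaterThanLessThan_iff exp_not_eq_zero not_False_eq_True)
      qed
    qed
    have cK: "continuous_on {0<..<\<delta>0} (K l)"
      using cK0 by (rule continuous_on_eq) (use K in auto)
    show "continuous_on {0<..<\<delta>} (h l)"
      unfolding h_def
      by (rule continuous_on_subset[OF _ sub]) (intro continuous_intros ca cK contg)
  qed (use h l \<delta> in auto)
  show ?thesis
  proof (rule that[of \<delta> "S \<delta>" "Z * J"])
    show "\<delta> > 0" "S \<delta> > 0" using \<delta> S(1) by auto
    show "t0 + \<sigma> * x \<in> P" if "0 < x" "x < \<delta>" for x using mem that \<delta> by auto
    fix l :: real assume l: "l \<ge> 0"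
    have ints: "set_integrable lborel {0<..<\<delta>} (\<lambda>x. \<Sum>m<M. g l m x * d m)"
      using intg[OF l] unfolding set_integrable_def scaleR_sum_right
      by (intro Bochner_Integration.integrable_sum) (simp flip: mult_scaleR_left)
    have "(LBINT x:{0<..<\<delta>}. of_real (K l x) * a (t0 + \<sigma> * x))
      = (LBINT x:{0<..<\<delta>}. h l x + (\<Sum>m<M. g l m x * d m))"
      by (simp add: h_def)
    also have "\<dots> = (LBINT x:{0<..<\<delta>}. h l x) + (LBINT x:{0<..<\<delta>}. (\<Sum>m<M. g l m x * d m))"
      using inth[OF l] ints by (rule set_integral_add)
    also have "(LBINT x:{0<..<\<delta>}. (\<Sum>m<M. g l m x * d m)) = (\<Sum>m<M. (LBINT x:{0<..<\<delta>}. g l m x * d m))"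
      using intg[OF l] unfolding set_integrable_def set_lebesgue_integral_def scaleR_sum_right
      by (intro Bochner_Integration.integral_sum) (simp flip: mult_scaleR_left)
    also have "\<dots> = (\<Sum>m<M. (LBINT s:{S \<delta><..}. tricomi_integrand l (chi \<alpha>0 \<beta>0 m) s) * d m)"
      using g_int[OF l] by simp
    finally have "norm ((LBINT x:{0<..<\<delta>}. of_real (K l x) * a (t0 + \<sigma> * x)) -
        (\<Sum>m<M. (LBINT s:{S \<delta><..}. tricomi_integrand l (chi \<alpha>0 \<beta>0 m) s) * d m)) = norm (LBINT x:{0<..<\<delta>}. h l x)"
      by simp
    also have "\<dots> \<le> (LBINT x:{0<..<\<delta>}. norm (h l x))"
      using inth[OF l] by (rule set_integral_norm_bound)
    also have "\<dots> \<le> (LBINT x:{0<..<\<delta>}. Z * exp (- 2 * sqrt (l * \<gamma>)) * x powr Re \<alpha>0)"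
      using inth[OF l] intJ h[OF l] \<delta> by (intro set_integral_mono set_integrable_norm) auto
    also have "\<dots> = Z * J * exp (- 2 * sqrt \<gamma> * sqrt l)"
      by (simp add: J_def real_sqrt_mult mult_ac)
    finally show "norm ((LBINT x:{0<..<\<delta>}. of_real (exp (- l * \<phi> (t0 + \<sigma> * x))) * a (t0 + \<sigma> * x)) -
        (\<Sum>m<M. (LBINT s:{S \<delta><..}. tricomi_integrand l (chi \<alpha>0 \<beta>0 m) s) * (of_real \<sigma> * coeff_c t0 T \<alpha>0 \<beta>0 q p m)))
      \<le> Z * J * exp (- 2 * sqrt (real M / \<beta>0) * sqrt l)"
      by (simp add: K_def d_def \<gamma>_def)
  qed
qed

section \<open>The contribution of the rest of the segment\<close>

text \<open>Near the endpoint \<open>T\<close> the limit of \<open>\<phi>\<close> bounds it from below, and what remains is compact.\<close>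

lemma segment_lower_bound_away_from_start:
  fixes T :: ereal and \<phi> :: "real \<Rightarrow> real"
  assumes T: "T \<noteq> ereal t0" and d: "\<delta> > 0"
  defines "P \<equiv> segment_from t0 T"
  assumes cont: "continuous_on P \<phi>" and pos: "\<And>t. t \<in> P \<Longrightarrow> \<phi> t > 0"
    and lim: "((\<lambda>x. ereal (\<phi> (real_of_ereal x))) \<longlongrightarrow> L) (at T within ereal ` P)" and L: "L > 0"
  obtains c where "c > 0" "\<And>t. t \<in> P \<Longrightarrow> \<bar>t - t0\<bar> \<ge> \<delta> \<Longrightarrow> \<phi> t \<ge> c"
proof -
  obtain c1 where c1: "0 < ereal c1" "ereal c1 < L"
    using ereal_dense2[OF L] by auto
  have "eventually (\<lambda>x. ereal c1 < ereal (\<phi> (real_of_ereal x))) (at T within ereal ` P)"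
    using lim c1(2) by (rule order_tendstoD)
  then obtain U where U: "open U" "T \<in> U"
    "\<And>x. x \<in> U \<Longrightarrow> x \<noteq> T \<Longrightarrow> x \<in> ereal ` P \<Longrightarrow> c1 < \<phi> (real_of_ereal x)"
    unfolding eventually_at_topological by auto
  obtain I where I: "compact I" "I \<subseteq> P"
    "\<And>t. t \<in> P \<Longrightarrow> \<bar>t - t0\<bar> \<ge> \<delta> \<Longrightarrow> t \<notin> I \<Longrightarrow> c1 < \<phi> t"
  proof (cases "ereal t0 < T")
    case True
    have P: "P = {t. t0 < t \<and> ereal t < T}"
      using True by (auto simp: P_def segment_from_def einterval_def)
    obtain b where b: "b < T" "{b<..T} \<subseteq> U"
      using open_left[OF U(1,2) True] by auto
    obtain b' where b': "max b (ereal t0) < ereal b'" "ereal b' < T"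
      using ereal_dense2[of "max b (ereal t0)" T] b True by auto
    show ?thesis
    proof (rule that[of "{t0 + \<delta>..b'}"])
      show "{t0 + \<delta>..b'} \<subseteq> P"
      proof
        fix t assume t: "t \<in> {t0 + \<delta>..b'}"
        then have "ereal t \<le> ereal b'" by simp
        then have "ereal t < T" using b'(2) by (rule le_less_trans)
        then show "t \<in> P" using t d P by auto
      qed
      fix t assume t: "t \<in> P" "\<bar>t - t0\<bar> \<ge> \<delta>" "t \<notin> {t0 + \<delta>..b'}"
      then have "b' < t" using P by auto
      then have "ereal b' < ereal t" by simp
      then have "b < ereal t" using b' by (meson less_trans max_less_iff_conj)
      then have "ereal t \<in> U" using b t P by auto
      then show "c1 < \<phi> t" using U(3)[of "ereal t"] t P by auto
    qed simp
  next
    case False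
    then have lt: "T < ereal t0" using T by auto
    have P: "P = {t. t < t0 \<and> T < ereal t}"
      using lt by (auto simp: P_def segment_from_def einterval_def min_def max_def)
    obtain b where b: "T < b" "{T..<b} \<subseteq> U"
      using open_right[OF U(1,2) lt] by auto
    obtain b' where b': "T < ereal b'" "ereal b' < min b (ereal t0)"
      using ereal_dense2[of T "min b (ereal t0)"] b lt by auto
    show ?thesis
    proof (rule that[of "{b'..t0 - \<delta>}"])
      show "{b'..t0 - \<delta>} \<subseteq> P"
      proof
        fix t assume t: "t \<in> {b'..t0 - \<delta>}"
        then have "ereal b' \<le> ereal t" by simp
        with b'(1) have "T < ereal t" by (rule less_le_trans)
        then show "t \<in> P" using t d P by auto
      qed
      fix t assume t: "t \<in> P" "\<bar>t - t0\<bar> \<ge> \<delta>" "t \<notin> {b'..t0 - \<delta>}"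
      then have "t < b'" using P by auto
      then have "ereal t < ereal b'" by simp
      then have "ereal t < b" using b' by (meson less_trans min_less_iff_conj)
      then have "ereal t \<in> U" using b t P by auto
      then show "c1 < \<phi> t" using U(3)[of "ereal t"] t P by auto
    qed simp
  qed
  obtain c2 where c2: "c2 > 0" "\<And>t. t \<in> I \<Longrightarrow> c2 \<le> \<phi> t"
  proof (cases "I = {}")
    case True
    then show ?thesis using that[of 1] by simp
  next
    case False
    then obtain t where "t \<in> I" "\<And>s. s \<in> I \<Longrightarrow> \<phi> t \<le> \<phi> s"
      using continuous_attains_inf[OF I(1) False continuous_on_subset[OF cont I(2)]] by auto
    then show ?thesis using that[of "\<phi> t"] pos I(2) by auto
  qed
  show ?thesis
  proof (rule that[of "min c1 c2"])
    show "min c1 c2 > 0" using c1 c2 by simp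
    show "min c1 c2 \<le> \<phi> t" if "t \<in> P" "\<bar>t - t0\<bar> \<ge> \<delta>" for t
      using I(3)[OF that] c2(2)[of t] by (cases "t \<in> I") auto
  qed
qed

lemma segment_from_measurable: "segment_from t0 T \<in> sets borel"
  by (simp add: segment_from_def)

lemma laplace_integrable:
  fixes a :: "real \<Rightarrow> complex"
  assumes P: "P \<in> sets borel" and c: "continuous_on P \<phi>" "continuous_on P a"
    and pos: "\<And>t. t \<in> P \<Longrightarrow> \<phi> t > 0"
    and int: "set_integrable lborel P (\<lambda>t. exp (- l0 * \<phi> t) * norm (a t))" and l: "l \<ge> l0"
  shows "set_integrable lborel P (\<lambda>t. of_real (exp (- l * \<phi> t)) * a t)"
proof (rule set_integrable_lborel_bound[OF int P])
  show "continuous_on P (\<lambda>t. of_real (exp (- l * \<phi> t)) * a t)"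
    by (intro continuous_intros c)
  fix t assume "t \<in> P"
  then have "l0 * \<phi> t \<le> l * \<phi> t" using pos[of t] l by (intro mult_right_mono) auto
  then show "norm (of_real (exp (- l * \<phi> t)) * a t) \<le> exp (- l0 * \<phi> t) * norm (a t)"
    by (simp add: norm_mult mult_right_mono)
qed

lemma laplace_split:
  fixes f :: "real \<Rightarrow> complex" and t0 :: real and T :: ereal
  defines "\<sigma> \<equiv> segment_sign t0 T"
  assumes int: "set_integrable lborel (segment_from t0 T) f"
    and mem: "\<And>x. 0 < x \<Longrightarrow> x < \<delta> \<Longrightarrow> t0 + \<sigma> * x \<in> segment_from t0 T"
  shows "(LBINT t:segment_from t0 T. f t) =
    (LBINT x:{0<..<\<delta>}. f (t0 + \<sigma> * x)) + (LBINT t:segment_from t0 T \<inter> {t. \<bar>t - t0\<bar> \<ge> \<delta>}. f t)"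
proof -
  let ?P = "segment_from t0 T"
  define A where "A = ?P \<inter> {t. \<bar>t - t0\<bar> < \<delta>}"
  define B where "B = ?P \<inter> {t. \<bar>t - t0\<bar> \<ge> \<delta>}"
  have meas: "A \<in> sets borel" "B \<in> sets borel"
    unfolding A_def B_def using segment_from_measurable by auto
  have AB: "A \<union> B = ?P" "A \<inter> B = {}" by (auto simp: A_def B_def)
  have "(LBINT t:?P. f t) = (LBINT t:A. f t) + (LBINT t:B. f t)"
    unfolding AB(1)[symmetric]
    using AB meas by (intro set_integral_Un set_integrable_subset[OF int]) auto
  also have "(LBINT t:A. f t) = \<bar>\<sigma>\<bar> *\<^sub>R (\<integral>x. indicator A (t0 + \<sigma> * x) *\<^sub>R f (t0 + \<sigma> * x) \<partial>lborel)"
    unfolding set_lebesgue_integral_def by (rule lborel_integral_real_affine) (simp add: \<sigma>_def)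
  also have "\<dots> = (LBINT x:{0<..<\<delta>}. f (t0 + \<sigma> * x))"
  proof -
    have "indicator A (t0 + \<sigma> * x) = (indicator {0<..<\<delta>} x :: real)" for x
    proof -
      have "t0 + \<sigma> * x \<in> A \<longleftrightarrow> 0 < x \<and> x < \<delta>"
      proof
        assume A: "t0 + \<sigma> * x \<in> A"
        have ab: "\<bar>t0 + \<sigma> * x - t0\<bar> = \<bar>x\<bar>" by (simp add: \<sigma>_def abs_mult)
        have "t0 + \<sigma> * x = t0 + \<sigma> * \<bar>t0 + \<sigma> * x - t0\<bar>" "t0 + \<sigma> * x \<noteq> t0"
          using segment_param_eq[of "t0 + \<sigma> * x" t0 T] A by (auto simp: A_def \<sigma>_def)
        then have "x = \<bar>x\<bar>" "x \<noteq> 0" unfolding ab by (auto simp: \<sigma>_def)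
        then show "0 < x \<and> x < \<delta>" using A ab by (auto simp: A_def)
      next
        assume "0 < x \<and> x < \<delta>"
        then show "t0 + \<sigma> * x \<in> A" using mem[of x] by (auto simp: A_def \<sigma>_def abs_mult)
      qed
      then show ?thesis by (simp add: indicator_def)
    qed
    then show ?thesis by (simp add: set_lebesgue_integral_def \<sigma>_def)
  qed
  finally show ?thesis by (simp add: B_def)
qed

lemma far_integral_bound:
  fixes a :: "real \<Rightarrow> complex"
  assumes B: "B \<in> sets borel" "B \<subseteq> P" "P \<in> sets borel" and c: "continuous_on P \<phi>" "continuous_on P a"
    and pos: "\<And>t. t \<in> P \<Longrightarrow> \<phi> t > 0"
    and low: "\<And>t. t \<in> B \<Longrightarrow> \<phi> t \<ge> c"
    and int: "set_integrable lborel P (\<lambda>t. exp (- l0 * \<phi> t) * norm (a t))" and l: "l \<ge> l0"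
  shows "norm (LBINT t:B. of_real (exp (- l * \<phi> t)) * a t) \<le>
    (exp (l0 * c) * (LBINT t:B. exp (- l0 * \<phi> t) * norm (a t))) * exp (- l * c)"
proof -
  have i1: "set_integrable lborel B (\<lambda>t. of_real (exp (- l * \<phi> t)) * a t)"
    using laplace_integrable[OF B(3) c pos int l] by (rule set_integrable_subset) (use B in auto)
  have i2: "set_integrable lborel B (\<lambda>t. exp (- l0 * \<phi> t) * norm (a t))"
    using int by (rule set_integrable_subset) (use B in auto)
  have "norm (LBINT t:B. of_real (exp (- l * \<phi> t)) * a t) \<le> (LBINT t:B. norm (of_real (exp (- l * \<phi> t)) * a t))"
    using i1 by (rule set_integral_norm_bound)
  also have "\<dots> \<le> (LBINT t:B. (exp (l0 * c) * exp (- l * c)) * (exp (- l0 * \<phi> t) * norm (a t)))"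
  proof (rule set_integral_mono)
    fix t assume t: "t \<in> B"
    have "(l - l0) * c \<le> (l - l0) * \<phi> t" using low[OF t] l by (intro mult_left_mono) auto
    then have "exp (- l * \<phi> t) \<le> exp (l0 * c) * exp (- l * c) * exp (- l0 * \<phi> t)"
      by (simp add: exp_add[symmetric] algebra_simps)
    then show "norm (of_real (exp (- l * \<phi> t)) * a t) \<le> (exp (l0 * c) * exp (- l * c)) * (exp (- l0 * \<phi> t) * norm (a t))"
      unfolding norm_mult by (simp add: mult_right_mono flip: mult.assoc)
  qed (use i1 i2 in \<open>auto intro: set_integrable_norm\<close>)
  also have "\<dots> = (exp (l0 * c) * (LBINT t:B. exp (- l0 * \<phi> t) * norm (a t))) * exp (- l * c)"
    by simp
  finally show ?thesis .
qed

section \<open>The asymptotic expansion\<close>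

theorem corollary4p1p4:
  fixes t0 :: real and T :: ereal
    and \<phi> :: "real \<Rightarrow> real" and a :: "real \<Rightarrow> complex"
    and \<phi>_t0 :: real and \<phi>_T :: ereal
    and l0 R \<beta>0 :: real and \<alpha>0 :: complex and q p :: "complex \<Rightarrow> complex"
  defines "P \<equiv> segment_from t0 T"
  defines "\<psi> \<equiv> (\<lambda>t. exp (1 - inverse (1 - exp (- \<phi> t))))"
  assumes "T \<noteq> ereal t0"
    and "continuous_on P \<phi>" and "continuous_on P a"
    and "\<And>t. t \<in> P \<Longrightarrow> \<phi> t > 0"
    and "(\<phi> \<longlongrightarrow> \<phi>_t0) (at t0 within P)"
    and "((\<lambda>x. ereal (\<phi> (real_of_ereal x))) \<longlongrightarrow> \<phi>_T) (at T within ereal ` P)"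
    and "\<phi>_t0 \<ge> 0"
    and "\<And>t. t \<in> P \<Longrightarrow> \<phi> t > \<phi>_t0"
    and "\<phi>_T > ereal \<phi>_t0"
    and "l0 \<ge> 0"
    and "set_integrable lborel P (\<lambda>t. exp (- l0 * \<phi> t) * norm (a t))"
    and "factorization_condition t0 T a \<psi> R \<alpha>0 \<beta>0 q p"
  shows "asymp_expansion
    (\<lambda>x. LBINT t:P. of_real (exp (- x * \<phi> t)) * a t)
    (\<lambda>n x. Gamma (of_real x + 1) * tricomi_U (of_real x + 1) 2 (chi \<alpha>0 \<beta>0 n))
    (\<lambda>n. exp (\<i> * of_real (segment_arg t0 T)) * coeff_c t0 T \<alpha>0 \<beta>0 q p n)"
  unfolding asymp_expansion_def
proof (intro allI impI)
  fix N :: nat assume N: "N \<ge> 1"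
  note T = assms(3) and c\<phi> = assms(4) and ca = assms(5) and pos = assms(6) and int = assms(13) and F = assms(14)
  have b: "\<beta>0 > 0" and al: "Re \<alpha>0 > -1" using F by (auto simp: factorization_condition_def)
  define \<sigma> where "\<sigma> = segment_sign t0 T"
  define d where "d = (\<lambda>n. of_real \<sigma> * coeff_c t0 T \<alpha>0 \<beta>0 q p n)"
  define z where "z = chi \<alpha>0 \<beta>0 (N - 1)"
  have chi_pos: "Re (chi \<alpha>0 \<beta>0 m) > 0" for m
    using al b by (simp add: chi_def)
  have z: "Re z > 0" unfolding z_def by (rule chi_pos)
  obtain M0 :: nat where M0: "\<beta>0 * (Re (csqrt z))\<^sup>2 < real M0"
    using reals_Archimedean2 by blast
  define M where "M = max N M0"
  have MN: "N \<le> M" by (simp add: M_def)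
  have k: "sqrt (real M / \<beta>0) > Re (csqrt z)"
  proof (rule real_less_rsqrt)
    have "\<beta>0 * (Re (csqrt z))\<^sup>2 < real M" using M0 unfolding M_def by linarith
    then show "(Re (csqrt z))\<^sup>2 < real M / \<beta>0" using b by (simp add: field_simps del: csqrt.sel)
  qed
  obtain \<delta> s1 C where \<delta>: "\<delta> > 0" and s1: "s1 > 0" and mem: "\<And>x. 0 < x \<Longrightarrow> x < \<delta> \<Longrightarrow> t0 + \<sigma> * x \<in> P"
    and near: "\<And>l. l \<ge> 0 \<Longrightarrow>
      norm ((LBINT x:{0<..<\<delta>}. of_real (exp (- l * \<phi> (t0 + \<sigma> * x))) * a (t0 + \<sigma> * x)) -
        (\<Sum>m<M. (LBINT s:{s1<..}. tricomi_integrand l (chi \<alpha>0 \<beta>0 m) s) * d m))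
      \<le> C * exp (- 2 * sqrt (real M / \<beta>0) * sqrt l)"
    unfolding d_def \<sigma>_def P_def
    by (rule near_integral_expansion[OF T ca[unfolded P_def] pos[unfolded P_def] F[unfolded \<psi>_def], where M = M]) blast+
  have "0 < \<phi>_T" using assms(9,11) by (metis ereal_less_eq(5) le_less_trans)
  then obtain c where c: "c > 0" "\<And>t. t \<in> P \<Longrightarrow> \<bar>t - t0\<bar> \<ge> \<delta> \<Longrightarrow> \<phi> t \<ge> c"
    using segment_lower_bound_away_from_start[OF T \<delta> c\<phi>[unfolded P_def] pos[unfolded P_def] assms(8)[unfolded P_def]]
    unfolding P_def by blast
  have mP: "P \<in> sets borel" unfolding P_def by (rule segment_from_measurable)
  define B where "B = P \<inter> {t. \<bar>t - t0\<bar> \<ge> \<delta>}"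
  have B: "B \<in> sets borel" "B \<subseteq> P" using mP by (auto simp: B_def)
  define L where "L = (\<lambda>l. LBINT t:P. of_real (exp (- l * \<phi> t)) * a t)"
  define near_rem where "near_rem = (\<lambda>l. (LBINT x:{0<..<\<delta>}. of_real (exp (- l * \<phi> (t0 + \<sigma> * x))) * a (t0 + \<sigma> * x)) -
        (\<Sum>m<M. (LBINT s:{s1<..}. tricomi_integrand l (chi \<alpha>0 \<beta>0 m) s) * d m))"
  define far where "far = (\<lambda>l. LBINT t:B. of_real (exp (- l * \<phi> t)) * a t)"
  define tail_rem where "tail_rem = (\<lambda>m l. tricomi_Phi l (chi \<alpha>0 \<beta>0 m) - (LBINT s:{s1<..}. tricomi_integrand l (chi \<alpha>0 \<beta>0 m) s))"
  let ?o = "o[at_top](\<lambda>x. tricomi_Phi x z)"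
  have near_o: "near_rem \<in> ?o"
  proof -
    have "near_rem \<in> O[at_top](\<lambda>l. of_real (exp (- 2 * sqrt (real M / \<beta>0) * sqrt l)))"
    proof (rule bigoI)
      show "eventually (\<lambda>l. norm (near_rem l) \<le> C * norm (complex_of_real (exp (- 2 * sqrt (real M / \<beta>0) * sqrt l)))) at_top"
        using eventually_ge_at_top[of 0]
      proof eventually_elim
        case (elim l)
        show ?case using near[OF elim] by (simp only: near_rem_def norm_of_real abs_exp_cancel)
      qed
    qed
    then show ?thesis
      using exp_sqrt_smallo_tricomi_Phi[OF z k] by (rule landau_o.big_small_trans)
  qed
  have far_o: "far \<in> ?o"
  proof -
    have "far \<in> O[at_top](\<lambda>l. of_real (exp (- l * c)))"
    proof (rule bigoI)
      show "eventually (\<lambda>l. norm (far l) \<le> exp (l0 * c) * (LBINT t:B. exp (- l0 * \<phi> t) * norm (a t)) * norm (complex_of_real (exp (- l * c)))) at_top"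
        using eventually_ge_at_top[of l0]
      proof eventually_elim
        case (elim l)
        have "norm (far l) \<le> exp (l0 * c) * (LBINT t:B. exp (- l0 * \<phi> t) * norm (a t)) * exp (- l * c)"
          unfolding far_def by (rule far_integral_bound[OF B mP c\<phi> ca pos _ int elim]) (use c in \<open>auto simp: B_def\<close>)
        then show ?case by simp
      qed
    qed
    then show ?thesis
      using exp_linear_smallo_tricomi_Phi[OF z c(1)] by (rule landau_o.big_small_trans)
  qed
  have tail_o: "tail_rem m \<in> ?o" for m
  proof -
    define e where "e = - ln (s1 / (1 + s1))"
    have e: "e > 0" using s1 by (simp add: e_def)
    have "tail_rem m \<in> O[at_top](\<lambda>l. of_real (exp (- l * e)))"
    proof (rule bigoI)
      show "eventually (\<lambda>l. norm (tail_rem m l) \<le> s1 * norm (complex_of_real (exp (- l * e)))) at_top"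
        using eventually_ge_at_top[of 0]
      proof eventually_elim
        case (elim l)
        have "norm (tail_rem m l) \<le> s1 * (s1 / (1 + s1)) powr l"
          unfolding tail_rem_def using s1 elim chi_pos by (rule tricomi_Phi_tail)
        also have "(s1 / (1 + s1)) powr l = exp (- l * e)" using s1 by (simp add: powr_def e_def)
        finally show ?case by simp
      qed
    qed
    then show ?thesis
      using exp_linear_smallo_tricomi_Phi[OF z e] by (rule landau_o.big_small_trans)
  qed
  have later_o: "(\<lambda>x. tricomi_Phi x (chi \<alpha>0 \<beta>0 m)) \<in> ?o" if "m \<ge> N" for m
  proof (rule tricomi_Phi_smallo_tricomi_Phi[OF z _ chi_pos])
    have "real m - real (N - 1) > 0" using that N by linarith
    then have r: "(real m - real (N - 1)) / \<beta>0 > 0" using b by simp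
    have "chi \<alpha>0 \<beta>0 m = z + of_real ((real m - real (N - 1)) / \<beta>0)"
      using b by (simp add: z_def chi_def add_divide_distrib diff_divide_distrib)
    then show "Re (csqrt z) < Re (csqrt (chi \<alpha>0 \<beta>0 m))"
      using Re_csqrt_add_pos_less[OF r z] by (simp only:)
  qed
  \<comment> \<open>The last sum adds back the terms from \<open>N\<close> to \<open>M - 1\<close>, which the local expansion contains and
    the partial sum up to \<open>N\<close> does not.\<close>
  have total: "(\<lambda>l. near_rem l + far l - (\<Sum>m<M. tail_rem m l * d m) +
      (\<Sum>m\<in>{N..<M}. tricomi_Phi l (chi \<alpha>0 \<beta>0 m) * d m)) \<in> ?o"
    using near_o far_o tail_o later_o
    by (intro sum_in_smallo big_sum_in_smallo landau_o.small.mult_in_1) auto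
  have ev: "eventually (\<lambda>l. near_rem l + far l - (\<Sum>m<M. tail_rem m l * d m) +
      (\<Sum>m\<in>{N..<M}. tricomi_Phi l (chi \<alpha>0 \<beta>0 m) * d m) =
      L l - (\<Sum>n<N. Gamma (of_real l + 1) * tricomi_U (of_real l + 1) 2 (chi \<alpha>0 \<beta>0 n) * d n)) at_top"
    using eventually_ge_at_top[of l0]
  proof eventually_elim
    case (elim l)
    then have l: "l \<ge> 0" using assms(12) by linarith
    have "L l = (LBINT x:{0<..<\<delta>}. of_real (exp (- l * \<phi> (t0 + \<sigma> * x))) * a (t0 + \<sigma> * x)) + far l"
      unfolding L_def far_def B_def P_def \<sigma>_def
      by (rule laplace_split)
         (use laplace_integrable[OF mP c\<phi> ca pos int elim] mem in \<open>auto simp: P_def \<sigma>_def\<close>)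
    moreover have "(\<Sum>m<M. tricomi_Phi l (chi \<alpha>0 \<beta>0 m) * d m) =
        (\<Sum>m<N. tricomi_Phi l (chi \<alpha>0 \<beta>0 m) * d m) + (\<Sum>m\<in>{N..<M}. tricomi_Phi l (chi \<alpha>0 \<beta>0 m) * d m)"
      using MN by (metis finite_atLeastLessThan lessThan_atLeast0 sum.atLeastLessThan_concat zero_le)
    moreover have "(\<Sum>m<M. tail_rem m l * d m) = (\<Sum>m<M. tricomi_Phi l (chi \<alpha>0 \<beta>0 m) * d m)
        - (\<Sum>m<M. (LBINT s:{s1<..}. tricomi_integrand l (chi \<alpha>0 \<beta>0 m) s) * d m)"
      unfolding tail_rem_def by (simp add: left_diff_distrib sum_subtractf)
    ultimately show ?case
      unfolding Gamma_mult_tricomi_U[OF l] near_rem_def by (simp add: algebra_simps)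
  qed
  have ev': "eventually (\<lambda>l. tricomi_Phi l z = Gamma (of_real l + 1) * tricomi_U (of_real l + 1) 2 z) at_top"
    using eventually_ge_at_top[of 0] by eventually_elim (simp add: Gamma_mult_tricomi_U)
  have "(\<lambda>l. L l - (\<Sum>n<N. Gamma (of_real l + 1) * tricomi_U (of_real l + 1) 2 (chi \<alpha>0 \<beta>0 n) * d n)) \<in> ?o"
    using total by (simp only: landau_o.small.in_cong[OF ev])
  then show "(\<lambda>x. (LBINT t:P. of_real (exp (- x * \<phi> t)) * a t)
      - (\<Sum>n<N. Gamma (of_real x + 1) * tricomi_U (of_real x + 1) 2 (chi \<alpha>0 \<beta>0 n) *
          (exp (\<i> * of_real (segment_arg t0 T)) * coeff_c t0 T \<alpha>0 \<beta>0 q p n)))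
    \<in> o[at_top](\<lambda>x. Gamma (of_real x + 1) * tricomi_U (of_real x + 1) 2 (chi \<alpha>0 \<beta>0 (N - 1)))"
    unfolding exp_segment_arg L_def d_def \<sigma>_def z_def[symmetric]
    by (simp only: landau_o.small.cong[OF ev'])
qed

end
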